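(* Let $\kappa$ be a nonzero real number. Let $\mathcal I$ be the right ideal of $SU_\mu(2)$ generated by the six elements $$\rho^2,\quad (\rho^* )^2,\quad \rho^*\rho=\rho\rho^*,\quad (\sigma-I)(\rho-\rho^* ),\quad (\sigma-I)(\rho+\rho^* ),\quad \sigma^*+\mu^2\sigma-(1+\mu^2)I$$ (the ideal defining Woronowicz's 3D left-covariant calculus), and let $\tilde R_0\subset\tilde E_\kappa(2)$ be its contraction, in the sense of the context. Then $\tilde R_0$ is the right ideal of $\tilde E_\kappa(2)$ generated by the following elements: $$(a_0-I)(a_0^*-I);$$ $$(a_0-I)w_0^*+\tfrac{1}{2\kappa}(a_0-a_0^* );\qquad (a_0-I)w_0-\tfrac{1}{2\kappa}(a_0-a_0^* );$$ $$(a_0^*-I)w_0^*-\tfrac{1}{2\kappa}(a_0-a_0^* );\qquad (a_0^*-I)w_0+\tfrac{1}{2\kappa}(a_0-a_0^* );$$ $$w_0^*w_0+\tfrac{1}{2\kappa}(w_0-3w_0^* )-\tfrac{1}{4\kappa^2}(a_0-a_0^* );$$ $$w_0^2+\tfrac{1}{2\kappa}(w_0^*-3w_0)+\tfrac{1}{4\kappa^2}(a_0-a_0^* );\qquad (w_0^* )^2-\tfrac{1}{2\kappa}(w_0-3w_0^* )+\tfrac{1}{4\kappa^2}(a_0-a_0^* ).$$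
   Context: $[x,y]=xy-yx$ and $I$ is the unit. The quantum group $SU_\mu(2)$: the unital $*$-algebra generated by $\sigma,\rho$ with relations $\rho\rho^*=\rho^*\rho$, $\mu(\rho-\rho^* )\sigma=\sigma(\rho-\rho^* )$, $\mu(\rho+\rho^* )\sigma=\sigma(\rho+\rho^* )$, $\sigma\sigma^*+\mu^2\rho\rho^*=I$, $\sigma^*\sigma+\rho\rho^*=I$ (and their adjoints). Contraction: put $\mu=e^{1/(\kappa R)}$, where $R$ is the contraction parameter, and write $h=1/R$ (formal, $h^*=h$). Consider $SU_\mu(2)$ over the field $\mathbb C((h))$ with $\mu=e^{h/\kappa}$. Define $a$ and $w$ by $$a=\tfrac12(\sigma+\rho-\mu\rho^*+\sigma^* ),\qquad \tfrac{1}{R}\,w=\tfrac12(-\sigma-\rho-\mu\rho^*+\sigma^* ),$$ equivalently $$\sigma=\tfrac{1}{1+\mu}\left(\mu a+a^*+\tfrac1R(w^*-\mu w)\right),\qquad \rho=\tfrac{1}{1+\mu}\left(a-a^*-\tfrac1R(w+w^* )\right).$$ Let $\mathcal L$ be the $\mathbb C[[h]]$-subalgebra generated by $a,a^*,w,w^*$. The limit $R\to\infty$ of $SU_\mu(2)$ is $\tilde E_\kappa(2)=\mathcal L/h\mathcal L$, and $a_0,a_0^*,w_0,w_0^*$ are the images of $a,a^*,w,w^*$. As an algebra $\tilde E_\kappa(2)$ is generated by $a_0,a_0^*,w_0,w_0^*$ with relations $a_0a_0^*=a_0^*a_0=I$, $[a_0,w_0]=-[a_0,w_0^*]=\frac1{2\kappa}(a_0^2-I)$,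 $[a_0^*,w_0]=-[a_0^*,w_0^*]=\frac1{2\kappa}((a_0^* )^2-I)$, $[w_0,w_0^*]=-\frac1{2\kappa}(a_0+a_0^* )(w_0+w_0^* )$. The contraction of a right ideal $\mathcal I$ of $SU_\mu(2)$ is the set of limits as $R\to\infty$ of elements of $\mathcal I$, i.e. the image of $\mathcal I\cap\mathcal L$ in $\mathcal L/h\mathcal L=\tilde E_\kappa(2)$; it is a right ideal of $\tilde E_\kappa(2)$. *)

theory Defs
  imports
    "HOL-Algebra.QuotRing"
    "HOL-Algebra.Generated_Rings"
    "HOL-Library.Poly_Mapping"
    "HOL-Computational_Algebra.Formal_Laurent_Series"
begin

section \<open>Right ideals\<close>

text \<open>In HOL-Algebra, \<^const>\<open>ideal\<close> and \<^const>\<open>genideal\<close> are two-sided.\<close>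

definition right_ideal :: "'a set \<Rightarrow> ('a, 'b) ring_scheme \<Rightarrow> bool"
  where "right_ideal I R \<longleftrightarrow>
    additive_subgroup I R \<and> (\<forall>x\<in>I. \<forall>r\<in>carrier R. x \<otimes>\<^bsub>R\<^esub> r \<in> I)"

definition right_genideal :: "('a, 'b) ring_scheme \<Rightarrow> 'a set \<Rightarrow> 'a set"
  where "right_genideal R S = \<Inter> {I. right_ideal I R \<and> S \<subseteq> I}"


section \<open>The free *-algebra on two generators over the formal Laurent series\<close>

text \<open>
  As an algebra, the free *-algebra on \<open>\<sigma>, \<rho>\<close> is the monoid algebra of the free monoid on the
  four letters \<open>\<sigma>, \<sigma>\<^sup>*, \<rho>, \<rho>\<^sup>*\<close>.  Monoids in \<^theory>\<open>HOL-Library.Poly_Mapping\<close> are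
  written additively, so concatenation of words is \<open>+\<close> and the empty word is \<open>0\<close>.
\<close>

datatype letter = Sig | Sig_star | Rho | Rho_star

datatype word = Word (letters: "letter list")

instantiation word :: monoid_add
begin

definition zero_word :: word where "zero_word = Word []"

definition plus_word :: "word \<Rightarrow> word \<Rightarrow> word" where "u + v = Word (letters u @ letters v)"

instance
  by standard (simp_all add: zero_word_def plus_word_def)

end

text \<open>The field \<open>\<complex>((h))\<close> is \<^typ>\<open>complex fls\<close>, with \<open>h\<close> being \<^const>\<open>fls_X\<close>.\<close>

type_synonym free_alg = "word \<Rightarrow>\<^sub>0 complex fls"

abbreviation scal :: "complex fls \<Rightarrow> free_alg" where "scal c \<equiv> Poly_Mapping.single 0 c"

definition gen :: "letter \<Rightarrow> free_alg" where "gen x = Poly_Mapping.single (Word [x]) 1"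

fun letter_star :: "letter \<Rightarrow> letter" where
  "letter_star Sig = Sig_star"
| "letter_star Sig_star = Sig"
| "letter_star Rho = Rho_star"
| "letter_star Rho_star = Rho"

definition word_star :: "word \<Rightarrow> word"
  where "word_star u = Word (rev (map letter_star (letters u)))"

text \<open>Complex conjugation of the coefficients; in particular \<open>h\<^sup>* = h\<close>.\<close>

definition fls_cnj :: "complex fls \<Rightarrow> complex fls"
  where "fls_cnj f = Abs_fls (\<lambda>n. cnj (fls_nth f n))"

text \<open>
  \<^const>\<open>word_star\<close> is an involution, so the coefficient of \<open>u\<close> in \<open>p\<^sup>*\<close> is the conjugate of the
  coefficient of \<open>u\<^sup>*\<close> in \<open>p\<close>.
\<close>

definition free_star :: "free_alg \<Rightarrow> free_alg"
  where "free_star p = Poly_Mapping.map fls_cnj (Poly_Mapping.map_key word_star p)"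

definition free_ring :: "free_alg ring"
  where "free_ring = \<lparr>carrier = UNIV, monoid.mult = (*), one = 1, ring.zero = 0, add = (+)\<rparr>"


section \<open>The quantum group \<open>SU\<^sub>\<mu>(2)\<close>\<close>

definition mu :: "real \<Rightarrow> complex fls"
  where "mu \<kappa> = fps_to_fls (fps_exp (complex_of_real (1 / \<kappa>)))"

definition su_relations :: "real \<Rightarrow> free_alg set" where
  "su_relations \<kappa> =
    (let \<sigma> = gen Sig; \<sigma>' = gen Sig_star; \<rho> = gen Rho; \<rho>' = gen Rho_star; \<mu> = scal (mu \<kappa>) in
     {\<rho> * \<rho>' - \<rho>' * \<rho>,
      \<mu> * (\<rho> - \<rho>') * \<sigma> - \<sigma> * (\<rho> - \<rho>'),
      \<mu> * (\<rho> + \<rho>') * \<sigma> - \<sigma> * (\<rho> + \<rho>'),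
      \<sigma> * \<sigma>' + \<mu>^2 * \<rho> * \<rho>' - 1,
      \<sigma>' * \<sigma> + \<rho> * \<rho>' - 1})"

definition su_kernel :: "real \<Rightarrow> free_alg set"
  where "su_kernel \<kappa> = genideal free_ring (su_relations \<kappa> \<union> free_star ` su_relations \<kappa>)"

definition SU :: "real \<Rightarrow> free_alg set ring"
  where "SU \<kappa> = free_ring Quot su_kernel \<kappa>"

definition su_class :: "real \<Rightarrow> free_alg \<Rightarrow> free_alg set"
  where "su_class \<kappa> p = su_kernel \<kappa> +>\<^bsub>free_ring\<^esub> p"

text \<open>The involution of the quotient; see \<open>su_star_class\<close> below.\<close>

definition su_star :: "free_alg set \<Rightarrow> free_alg set"
  where "su_star X = free_star ` X"

definition woronowicz_ideal :: "real \<Rightarrow> free_alg set set" where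
  "woronowicz_ideal \<kappa> =
    (let \<sigma> = gen Sig; \<sigma>' = gen Sig_star; \<rho> = gen Rho; \<rho>' = gen Rho_star; \<mu> = scal (mu \<kappa>) in
     right_genideal (SU \<kappa>) (su_class \<kappa> `
       {\<rho>^2,
        \<rho>'^2,
        \<rho>' * \<rho>,
        (\<sigma> - 1) * (\<rho> - \<rho>'),
        (\<sigma> - 1) * (\<rho> + \<rho>'),
        \<sigma>' + \<mu>^2 * \<sigma> - (1 + \<mu>^2)}))"


section \<open>The contraction\<close>

definition su_a :: "real \<Rightarrow> free_alg set" where
  "su_a \<kappa> = su_class \<kappa> (scal (1/2) *
     (gen Sig + gen Rho - scal (mu \<kappa>) * gen Rho_star + gen Sig_star))"

text \<open>Here \<^const>\<open>fls_X_inv\<close> is the contraction parameter \<open>R = 1/h\<close>.\<close>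

definition su_w :: "real \<Rightarrow> free_alg set" where
  "su_w \<kappa> = su_class \<kappa> (scal (fls_X_inv * (1/2)) *
     (- gen Sig - gen Rho - scal (mu \<kappa>) * gen Rho_star + gen Sig_star))"

text \<open>
  The \<open>\<complex>[[h]]\<close>-subalgebra generated by \<open>a, a\<^sup>*, w, w\<^sup>*\<close> is the subring generated by these
  elements together with the scalars in \<open>\<complex>[[h]]\<close>.
\<close>

definition lattice_alg :: "real \<Rightarrow> free_alg set set" where
  "lattice_alg \<kappa> = generate_ring (SU \<kappa>)
     ({su_a \<kappa>, su_star (su_a \<kappa>), su_w \<kappa>, su_star (su_w \<kappa>)} \<union>
      {su_class \<kappa> (scal (fps_to_fls f)) | f. True})"

definition lattice_ring :: "real \<Rightarrow> free_alg set ring"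
  where "lattice_ring \<kappa> = (SU \<kappa>)\<lparr>carrier := lattice_alg \<kappa>\<rparr>"

definition h_lattice :: "real \<Rightarrow> free_alg set set"
  where "h_lattice \<kappa> = {su_class \<kappa> (scal fls_X) \<otimes>\<^bsub>SU \<kappa>\<^esub> x | x. x \<in> lattice_alg \<kappa>}"

definition E_tilde :: "real \<Rightarrow> free_alg set set ring"
  where "E_tilde \<kappa> = lattice_ring \<kappa> Quot h_lattice \<kappa>"

definition limit_class :: "real \<Rightarrow> free_alg set \<Rightarrow> free_alg set set"
  where "limit_class \<kappa> x = h_lattice \<kappa> +>\<^bsub>lattice_ring \<kappa>\<^esub> x"

text \<open>The structure map of the \<open>\<complex>\<close>-algebra \<^const>\<open>E_tilde\<close>.\<close>

definition limit_scal :: "real \<Rightarrow> complex \<Rightarrow> free_alg set set"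
  where "limit_scal \<kappa> c = limit_class \<kappa> (su_class \<kappa> (scal (fls_const c)))"

definition contraction :: "real \<Rightarrow> free_alg set set \<Rightarrow> free_alg set set set"
  where "contraction \<kappa> I = limit_class \<kappa> ` (I \<inter> lattice_alg \<kappa>)"


section \<open>Well-definedness of the constructions\<close>

lemma right_ideal_right_genideal:
  assumes "ring R" "S \<subseteq> carrier R"
  shows "right_ideal (right_genideal R S) R" "S \<subseteq> right_genideal R S"
proof -
  interpret ring R by fact
  have carr: "right_ideal (carrier R) R"
    unfolding right_ideal_def additive_subgroup_def
    by (auto intro: add.subgroup_self)
  let ?F = "{I. right_ideal I R \<and> S \<subseteq> I}"
  have "subgroup (\<Inter> ?F) (add_monoid R)"
    using carr assms(2)
    by (intro add.subgroups_Inter) (auto simp: right_ideal_def additive_subgroup_def)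
  then show "right_ideal (right_genideal R S) R"
    by (auto simp: right_ideal_def additive_subgroup_def right_genideal_def)
  show "S \<subseteq> right_genideal R S"
    by (auto simp: right_genideal_def)
qed

lemma ring_free_ring: "ring free_ring"
  by (rule ringI, rule abelian_groupI, simp_all add: free_ring_def algebra_simps)
    (metis add.left_inverse add.commute, unfold_locales, simp_all add: algebra_simps)

lemma carrier_free_ring [simp]: "carrier free_ring = UNIV"
  by (simp add: free_ring_def)

lemma ideal_su_kernel: "ideal (su_kernel \<kappa>) free_ring"
  unfolding su_kernel_def by (rule ring.genideal_ideal[OF ring_free_ring]) simp

lemma ring_SU: "ring (SU \<kappa>)"
  unfolding SU_def by (rule ideal.quotient_is_ring[OF ideal_su_kernel])

lemma su_class_hom: "su_class \<kappa> \<in> ring_hom free_ring (SU \<kappa>)"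
  using ideal.rcos_ring_hom[OF ideal_su_kernel] by (simp add: SU_def su_class_def[abs_def])

lemma su_class_carrier: "su_class \<kappa> p \<in> carrier (SU \<kappa>)"
  by (rule ring_hom_closed[OF su_class_hom]) simp

lemma word_star_word_star [simp]: "word_star (word_star u) = u"
proof -
  have "letter_star (letter_star x) = x" for x by (cases x) auto
  then show ?thesis by (simp add: word_star_def rev_map comp_def)
qed

lemma inj_word_star: "inj word_star"
  by (metis injI word_star_word_star)

lemma word_star_add: "word_star (u + v) = word_star v + word_star u"
  by (simp add: word_star_def plus_word_def)

lemma fls_nth_cnj [simp]: "fls_nth (fls_cnj f) n = cnj (fls_nth f n)"
  unfolding fls_cnj_def
  by (rule nth_Abs_fls_lower_bound[of "fls_subdegree f"]) simp

lemma fls_cnj_simps [simp]: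
  "fls_cnj 0 = 0" "fls_cnj 1 = 1" "fls_cnj (f + g) = fls_cnj f + fls_cnj g"
  "fls_cnj (- f) = - fls_cnj f" "fls_cnj (fls_cnj f) = f" "fls_cnj fls_X = fls_X"
  by (auto intro!: fls_eqI)

lemma fls_subdegree_cnj [simp]: "fls_subdegree (fls_cnj f) = fls_subdegree f"
proof (cases "f = 0")
  case False
  then show ?thesis by (intro fls_subdegree_eqI) auto
qed simp

lemma fls_cnj_mult: "fls_cnj (f * g) = fls_cnj f * fls_cnj g"
  by (rule fls_eqI) (simp add: fls_times_nth(1))

lemma lookup_free_star:
  "poly_mapping.lookup (free_star p) u = fls_cnj (poly_mapping.lookup p (word_star u))"
  unfolding free_star_def
  by (simp add: Poly_Mapping.map.rep_eq Poly_Mapping.map_key.rep_eq inj_word_star comp_def when_def)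

lemma free_star_add: "free_star (p + q) = free_star p + free_star q"
  by (rule poly_mapping_eqI) (simp add: lookup_free_star lookup_add)

lemma free_star_zero: "free_star 0 = 0"
  by (rule poly_mapping_eqI) (simp add: lookup_free_star)

lemma free_star_uminus: "free_star (- p) = - free_star p"
  by (rule poly_mapping_eqI) (simp add: lookup_free_star)

lemma free_star_free_star [simp]: "free_star (free_star p) = p"
  by (rule poly_mapping_eqI) (simp add: lookup_free_star)

lemma free_star_single:
  "free_star (Poly_Mapping.single u c) = Poly_Mapping.single (word_star u) (fls_cnj c)"
  by (rule poly_mapping_eqI) (auto simp: lookup_free_star lookup_single when_def)

lemma free_alg_induct:
  fixes p :: free_alg
  assumes "P 0" "\<And>u c q. P q \<Longrightarrow> P (Poly_Mapping.single u c + q)"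
  shows "P p"
proof (induction p rule: Poly_Mapping.update_induct)
  case const
  show ?case by fact
next
  case (update f u c)
  have "Poly_Mapping.update u c f = Poly_Mapping.single u c + f"
    using update by (intro poly_mapping_eqI)
      (auto simp: lookup_update lookup_add lookup_single when_def in_keys_iff)
  with update assms(2) show ?case by simp
qed

lemma free_star_mult: "free_star (p * q) = free_star q * free_star p"
proof (induction p rule: free_alg_induct)
  case 1
  then show ?case by (simp add: free_star_zero)
next
  case (2 u c p)
  have "free_star (Poly_Mapping.single u c * q) = free_star q * free_star (Poly_Mapping.single u c)"
  proof (induction q rule: free_alg_induct)
    case 1
    then show ?case by (simp add: free_star_zero)
  next
    case (2 v d q)
    then show ?case
      by (simp add: distrib_left distrib_right free_star_add mult_single free_star_single
          word_star_add fls_cnj_mult mult.commute)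
  qed
  with 2 show ?case by (simp add: distrib_left distrib_right free_star_add)
qed

lemma free_star_gen [simp]: "free_star (gen x) = gen (letter_star x)"
  by (simp add: gen_def free_star_single word_star_def)

lemma free_star_su_kernel: "free_star ` su_kernel \<kappa> = su_kernel \<kappa>"
proof -
  interpret K: ideal "su_kernel \<kappa>" free_ring by (rule ideal_su_kernel)
  have add: "p + q \<in> su_kernel \<kappa>" if "p \<in> su_kernel \<kappa>" "q \<in> su_kernel \<kappa>" for p q
    using additive_subgroup.a_closed[OF K.additive_subgroup_axioms that] by (simp add: free_ring_def)
  have zero: "0 \<in> su_kernel \<kappa>"
    using additive_subgroup.zero_closed[OF K.additive_subgroup_axioms] by (simp add: free_ring_def)
  have minus: "- p \<in> su_kernel \<kappa>" if "p \<in> su_kernel \<kappa>" for p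
    using K.I_l_closed[OF that, of "- 1"] by (simp add: free_ring_def)
  have mult: "p * q \<in> su_kernel \<kappa>" "q * p \<in> su_kernel \<kappa>" if "p \<in> su_kernel \<kappa>" for p q
    using K.I_l_closed[OF that, of q] K.I_r_closed[OF that, of q] by (simp_all add: free_ring_def)
  let ?S = "su_relations \<kappa> \<union> free_star ` su_relations \<kappa>"
  have S: "?S \<subseteq> su_kernel \<kappa>"
    unfolding su_kernel_def by (rule ring.genideal_self[OF ring_free_ring]) simp
  have "ideal (free_star -` su_kernel \<kappa>) free_ring"
  proof (rule idealI[OF ring_free_ring])
    show "subgroup (free_star -` su_kernel \<kappa>) (add_monoid free_ring)"
    proof (rule group.subgroupI)
      show "group (add_monoid free_ring)"
        using ring.is_abelian_group[OF ring_free_ring] abelian_group.a_group by blast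
      show "free_star -` su_kernel \<kappa> \<noteq> {}"
        using zero free_star_zero by (metis empty_iff vimageI2)
      fix p assume p: "p \<in> free_star -` su_kernel \<kappa>"
      have "p \<oplus>\<^bsub>free_ring\<^esub> - p = \<zero>\<^bsub>free_ring\<^esub>" by (simp add: free_ring_def)
      then have "\<ominus>\<^bsub>free_ring\<^esub> p = - p" by (metis K.minus_equality K.a_comm carrier_free_ring UNIV_I)
      then show "inv\<^bsub>add_monoid free_ring\<^esub> p \<in> free_star -` su_kernel \<kappa>"
        using p minus by (simp add: a_inv_def free_star_uminus)
    next
      fix p q assume "p \<in> free_star -` su_kernel \<kappa>" "q \<in> free_star -` su_kernel \<kappa>"
      then show "p \<otimes>\<^bsub>add_monoid free_ring\<^esub> q \<in> free_star -` su_kernel \<kappa>"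
        by (simp add: free_ring_def free_star_add add)
    qed simp
  qed (auto simp: free_ring_def free_star_mult mult)
  moreover have "?S \<subseteq> free_star -` su_kernel \<kappa>"
    using S by auto
  ultimately have "su_kernel \<kappa> \<subseteq> free_star -` su_kernel \<kappa>"
    using ring.genideal_minimal[OF ring_free_ring] unfolding su_kernel_def by blast
  then have sub: "free_star p \<in> su_kernel \<kappa>" if "p \<in> su_kernel \<kappa>" for p
    using that by blast
  show ?thesis
  proof
    show "free_star ` su_kernel \<kappa> \<subseteq> su_kernel \<kappa>"
      using sub by blast
    show "su_kernel \<kappa> \<subseteq> free_star ` su_kernel \<kappa>"
      by (metis sub free_star_free_star image_eqI subsetI)
  qed
qed

lemma su_star_class: "su_star (su_class \<kappa> p) = su_class \<kappa> (free_star p)"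
proof -
  have "su_star (su_class \<kappa> p) = (\<lambda>q. q + free_star p) ` free_star ` su_kernel \<kappa>"
    by (auto simp: su_star_def su_class_def a_r_coset_def r_coset_def free_ring_def
        free_star_add image_iff)
  then show ?thesis
    by (auto simp: free_star_su_kernel su_class_def a_r_coset_def r_coset_def free_ring_def)
qed

lemma scal_commute: "scal c * p = p * scal c"
proof (induction p rule: free_alg_induct)
  case (2 u d q)
  then show ?case by (simp add: distrib_left distrib_right mult_single mult.commute)
qed simp

lemma fls_cnj_mu [simp]: "fls_cnj (mu \<kappa>) = mu \<kappa>"
  by (rule fls_eqI) (simp add: mu_def)

lemma fls_cnj_half [simp]: "fls_cnj (1/2) = 1/2"
proof -
  have "fls_cnj (1 + 1) * fls_cnj (1/2) = 1"
    unfolding fls_cnj_mult[symmetric] by simp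
  then have "fls_cnj (1/2) * 2 = 1"
    by (metis mult.commute one_add_one fls_cnj_simps(2,3))
  then show ?thesis
    by (metis nonzero_mult_div_cancel_right zero_neq_numeral)
qed

lemma fls_cnj_X_inv [simp]: "fls_cnj fls_X_inv = fls_X_inv"
  by (rule fls_eqI) auto

lemma free_star_scal [simp]: "free_star (scal c) = scal (fls_cnj c)"
  by (simp add: free_star_single word_star_def zero_word_def)

lemma free_star_diff: "free_star (p - q) = free_star p - free_star q"
  by (metis diff_conv_add_uminus free_star_add free_star_uminus)

lemma su_star_a: "su_star (su_a \<kappa>) = su_class \<kappa> (scal (1/2) *
     (gen Sig_star + gen Rho_star - scal (mu \<kappa>) * gen Rho + gen Sig))"
  by (simp add: su_a_def su_star_class free_star_add free_star_diff free_star_mult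
      scal_commute[symmetric])

lemma su_star_w: "su_star (su_w \<kappa>) = su_class \<kappa> (scal (fls_X_inv * (1/2)) *
     (- gen Sig_star - gen Rho_star - scal (mu \<kappa>) * gen Rho + gen Sig))"
  by (simp add: su_w_def su_star_class free_star_add free_star_diff free_star_uminus
      free_star_mult fls_cnj_mult scal_commute[symmetric]
      del: times_divide_eq_right mult_1_right)

lemma lattice_generators_carrier:
  "{su_a \<kappa>, su_star (su_a \<kappa>), su_w \<kappa>, su_star (su_w \<kappa>)} \<union>
      {su_class \<kappa> (scal (fps_to_fls f)) | f. True} \<subseteq> carrier (SU \<kappa>)"
  by (auto simp: su_a_def su_w_def su_star_class su_class_carrier)

lemma ring_lattice_ring: "ring (lattice_ring \<kappa>)"
  unfolding lattice_ring_def lattice_alg_def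
  by (rule ring.generate_ring_is_ring[OF ring_SU lattice_generators_carrier])

lemma lattice_alg_carrier: "lattice_alg \<kappa> \<subseteq> carrier (SU \<kappa>)"
  unfolding lattice_alg_def
  by (rule ring.generate_ring_incl[OF ring_SU lattice_generators_carrier])

lemma su_scal_commute:
  assumes "x \<in> carrier (SU \<kappa>)"
  shows "su_class \<kappa> (scal c) \<otimes>\<^bsub>SU \<kappa>\<^esub> x = x \<otimes>\<^bsub>SU \<kappa>\<^esub> su_class \<kappa> (scal c)"
proof -
  obtain p where x: "x = su_class \<kappa> p"
    using assms by (auto simp: SU_def FactRing_def A_RCOSETS_def RCOSETS_def su_class_def a_r_coset_def)
  have "su_class \<kappa> (p * q) = su_class \<kappa> p \<otimes>\<^bsub>SU \<kappa>\<^esub> su_class \<kappa> q" for p q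
    using ring_hom_mult[OF su_class_hom, of p q] by (simp add: free_ring_def)
  then show ?thesis
    using scal_commute[of c p] by (metis x)
qed

lemma ideal_h_lattice: "ideal (h_lattice \<kappa>) (lattice_ring \<kappa>)"
proof -
  interpret S: ring "SU \<kappa>" by (rule ring_SU)
  interpret L: ring "lattice_ring \<kappa>" by (rule ring_lattice_ring)
  let ?L = "lattice_alg \<kappa>" and ?h = "su_class \<kappa> (scal fls_X)"
  have h: "?h \<in> ?L"
    unfolding lattice_alg_def
    by (rule generate_ring.incl, rule UnI2, rule CollectI, rule exI[of _ fps_X]) simp
  have L: "carrier (lattice_ring \<kappa>) = ?L" "x \<otimes>\<^bsub>lattice_ring \<kappa>\<^esub> y = x \<otimes>\<^bsub>SU \<kappa>\<^esub> y" for x y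
    by (simp_all add: lattice_ring_def)
  have hL: "h_lattice \<kappa> = (\<lambda>x. ?h \<otimes>\<^bsub>lattice_ring \<kappa>\<^esub> x) ` ?L"
    by (auto simp: h_lattice_def L)
  have comm: "?h \<otimes>\<^bsub>lattice_ring \<kappa>\<^esub> x = x \<otimes>\<^bsub>lattice_ring \<kappa>\<^esub> ?h" if "x \<in> ?L" for x
    unfolding L by (rule su_scal_commute) (use that lattice_alg_carrier in blast)
  show ?thesis
  proof (rule idealI[OF ring_lattice_ring])
    show "subgroup (h_lattice \<kappa>) (add_monoid (lattice_ring \<kappa>))"
    proof (rule L.add.subgroupI)
      show "h_lattice \<kappa> \<subseteq> carrier (lattice_ring \<kappa>)"
        using h L.m_closed by (auto simp: hL L(1))
      show "h_lattice \<kappa> \<noteq> {}"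
        using h by (auto simp: hL)
    next
      fix x assume "x \<in> h_lattice \<kappa>"
      then obtain y where y: "y \<in> ?L" "x = ?h \<otimes>\<^bsub>lattice_ring \<kappa>\<^esub> y" by (auto simp: hL)
      then have "\<ominus>\<^bsub>lattice_ring \<kappa>\<^esub> x = ?h \<otimes>\<^bsub>lattice_ring \<kappa>\<^esub> (\<ominus>\<^bsub>lattice_ring \<kappa>\<^esub> y)"
        using h by (simp add: L.r_minus L(1))
      then show "\<ominus>\<^bsub>lattice_ring \<kappa>\<^esub> x \<in> h_lattice \<kappa>"
        using y L.a_inv_closed by (auto simp: hL L(1))
    next
      fix x x' assume "x \<in> h_lattice \<kappa>" "x' \<in> h_lattice \<kappa>"
      then obtain y y' where y: "y \<in> ?L" "x = ?h \<otimes>\<^bsub>lattice_ring \<kappa>\<^esub> y"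
        "y' \<in> ?L" "x' = ?h \<otimes>\<^bsub>lattice_ring \<kappa>\<^esub> y'" by (auto simp: hL)
      then have "x \<oplus>\<^bsub>lattice_ring \<kappa>\<^esub> x' = ?h \<otimes>\<^bsub>lattice_ring \<kappa>\<^esub> (y \<oplus>\<^bsub>lattice_ring \<kappa>\<^esub> y')"
        using h by (simp add: L.r_distr L(1))
      then show "x \<oplus>\<^bsub>lattice_ring \<kappa>\<^esub> x' \<in> h_lattice \<kappa>"
        using y L.a_closed by (auto simp: hL L(1))
    qed
  next
    fix x r assume "x \<in> h_lattice \<kappa>" and r: "r \<in> carrier (lattice_ring \<kappa>)"
    then obtain y where y: "y \<in> ?L" "x = ?h \<otimes>\<^bsub>lattice_ring \<kappa>\<^esub> y" by (auto simp: hL)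
    have "x \<otimes>\<^bsub>lattice_ring \<kappa>\<^esub> r = ?h \<otimes>\<^bsub>lattice_ring \<kappa>\<^esub> (y \<otimes>\<^bsub>lattice_ring \<kappa>\<^esub> r)"
      using y r h by (simp add: L.m_assoc L(1))
    then show "x \<otimes>\<^bsub>lattice_ring \<kappa>\<^esub> r \<in> h_lattice \<kappa>"
      using y r L.m_closed by (auto simp: hL L(1))
    have "r \<otimes>\<^bsub>lattice_ring \<kappa>\<^esub> x = ?h \<otimes>\<^bsub>lattice_ring \<kappa>\<^esub> (r \<otimes>\<^bsub>lattice_ring \<kappa>\<^esub> y)"
      using y r h comm[of r] L.m_assoc by (metis L(1))
    then show "r \<otimes>\<^bsub>lattice_ring \<kappa>\<^esub> x \<in> h_lattice \<kappa>"
      using y r L.m_closed by (auto simp: hL L(1))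
  qed
qed

lemma ring_E_tilde: "ring (E_tilde \<kappa>)"
  unfolding E_tilde_def by (rule ideal.quotient_is_ring[OF ideal_h_lattice])

end

theory Submission
  imports Defs
begin

text \<open>
  Write \<open>A\<close> for \<open>SU\<^sub>\<mu>(2)\<close>, \<open>I\<close> for the Woronowicz ideal, \<open>L\<close> for the \<open>\<complex>[[h]]\<close>-subalgebra, and
  \<open>J\<close> for the right ideal of \<open>E = L / h L\<close> generated by the eight elements.  The idea is to
  understand the four-dimensional right module \<open>A / I\<close> explicitly, to see that the image of \<open>L\<close> in
  it lies in a free \<open>\<complex>[[h]]\<close>-lattice of rank four, and to compare with \<open>E / J\<close>.

  As a vector space \<open>A / I\<close> has the basis \<open>1, \<rho>, \<rho>\<^sup>*, \<sigma> - 1\<close>, and right multiplication acts on it by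
  triangular matrices: on the last three basis vectors it is given by the characters \<open>f\<^sub>s\<close> with
  \<open>f\<^sub>s(\<sigma>) = s\<^sup>-\<^sup>1\<close>, \<open>f\<^sub>s(\<sigma>\<^sup>*) = s\<close>, \<open>f\<^sub>s(\<rho>) = f\<^sub>s(\<rho>\<^sup>*) = 0\<close>, where \<open>s = \<mu>\<close> for \<open>\<rho>, \<rho>\<^sup>*\<close> and
  \<open>s = \<mu>\<^sup>2\<close> for \<open>\<sigma> - 1\<close>.  So \<open>I\<close> is the common kernel of the counit \<open>\<epsilon> = f\<^sub>1\<close> and of three functionals
  \<open>\<chi>\<close> satisfying \<open>\<chi>(x y) = \<epsilon>(x) \<chi>(y) + \<chi>(x) f\<^sub>s(y)\<close> (\<open>worono_iff\<close>).  They are chosen here as the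
  coordinates with respect to \<open>1\<close>, \<open>\<rho>\<close>, \<open>T = (\<rho> + \<rho>\<^sup>*) / h\<close> and a unit multiple of
  \<open>U = (\<sigma> - \<sigma>\<^sup>*) / h\<close>.  With this choice they are power series on all of \<open>L\<close> (\<open>lat_functionals\<close>), and \<open>L\<close>
  contains elements with arbitrary power series as coordinates, because \<open>\<rho>, T, U \<in> L\<close>.

  Hence an element of \<open>L\<close> whose four coordinates have vanishing constant term can be changed by an
  element of \<open>h L\<close> so as to lie in \<open>I\<close>, so that its class belongs to the contraction
  (\<open>contractionI\<close>).  The constant terms follow the same multiplication rules over \<open>\<complex>\<close>, and a
  computation with complex numbers shows that they vanish on the eight elements
  (\<open>limit_generators_ct\<close>).  This gives \<open>J \<subseteq> R\<^sub>0\<close>, where \<open>R\<^sub>0\<close> is the contraction of \<open>I\<close>.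

  Conversely, the commutation relations of \<open>E\<close> (\<open>limit_relations\<close>) show that
  \<open>J + span\<^sub>\<complex>(1, \<rho>, w, w\<^sup>*)\<close> is closed under right multiplication, so it is all of \<open>E\<close>
  (\<open>limit_ideal_span\<close>).  The constant terms of the coordinates of \<open>1, \<rho>, w, w\<^sup>*\<close> are linearly independent
  and those of elements of \<open>J\<close> vanish.  An element of \<open>I \<inter> L\<close> has coordinates zero, so its class is
  in \<open>J\<close> (\<open>worono_lat_limit_ideal\<close>).

  All computations take place with representatives in the free algebra.
\<close>

section \<open>Right ideals of an image of a subring\<close>

text \<open>
  A ring \<open>R\<close> in the sense of carrier sets is often the image of a subring \<open>S\<close> of some type in class
  \<^class>\<open>ring_1\<close>.  This locale transports sums, products and right ideals between the two.
\<close>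

locale ring_presentation =
  fixes S :: "'a::ring_1 set" and \<phi> :: "'a \<Rightarrow> 'b" and R :: "('b, 'c) ring_scheme" (structure)
  assumes ring_R: "ring R"
    and one_S: "1 \<in> S"
    and uminus_S: "p \<in> S \<Longrightarrow> - p \<in> S"
    and add_S: "p \<in> S \<Longrightarrow> q \<in> S \<Longrightarrow> p + q \<in> S"
    and mult_S: "p \<in> S \<Longrightarrow> q \<in> S \<Longrightarrow> p * q \<in> S"
    and image_S: "\<phi> ` S = carrier R"
    and hom_one: "\<phi> 1 = \<one>"
    and hom_add: "p \<in> S \<Longrightarrow> q \<in> S \<Longrightarrow> \<phi> (p + q) = \<phi> p \<oplus> \<phi> q"
    and hom_mult: "p \<in> S \<Longrightarrow> q \<in> S \<Longrightarrow> \<phi> (p * q) = \<phi> p \<otimes> \<phi> q"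
begin

sublocale ring R by (rule ring_R)

lemma hom_carrier: "p \<in> S \<Longrightarrow> \<phi> p \<in> carrier R"
  using image_S by blast

lemma diff_S: "p \<in> S \<Longrightarrow> q \<in> S \<Longrightarrow> p - q \<in> S"
  using add_S[of p "- q"] uminus_S[of q] by simp

lemma zero_S: "0 \<in> S"
  using diff_S[OF one_S one_S] by simp

lemma hom_zero: "\<phi> 0 = \<zero>"
proof -
  have "\<phi> 0 \<oplus> \<phi> 0 = \<phi> 0"
    using hom_add[OF zero_S zero_S] by simp
  then show ?thesis
    by (simp add: hom_carrier zero_S)
qed

lemma hom_uminus:
  assumes "p \<in> S" shows "\<phi> (- p) = \<ominus> \<phi> p"
proof -
  have "\<phi> (- p) \<oplus> \<phi> p = \<zero>"
    using hom_add[OF uminus_S[OF assms] assms] by (simp add: hom_zero)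
  then show ?thesis
    using assms by (simp add: hom_carrier uminus_S minus_equality)
qed

lemma hom_diff: "p \<in> S \<Longrightarrow> q \<in> S \<Longrightarrow> \<phi> (p - q) = \<phi> p \<ominus> \<phi> q"
  using hom_add[of p "- q"] by (simp add: hom_uminus uminus_S a_minus_def)

lemma right_ideal_image:
  assumes "P \<subseteq> S" "0 \<in> P"
    and add: "\<And>p q. p \<in> P \<Longrightarrow> q \<in> P \<Longrightarrow> p + q \<in> P"
    and mult: "\<And>p q. p \<in> P \<Longrightarrow> q \<in> S \<Longrightarrow> p * q \<in> P"
  shows "right_ideal (\<phi> ` P) R"
proof -
  have neg: "- p \<in> P" if "p \<in> P" for p
    using mult[OF that uminus_S[OF one_S]] by simp
  have "subgroup (\<phi> ` P) (add_monoid R)"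
  proof (rule add.subgroupI)
    show "\<phi> ` P \<subseteq> carrier R"
      using assms(1) hom_carrier by blast
    show "\<phi> ` P \<noteq> {}"
      using assms(2) by blast
    show "\<ominus> x \<in> \<phi> ` P" if "x \<in> \<phi> ` P" for x
      using that neg assms(1) by (force simp: hom_uminus[symmetric] subset_iff)
    show "x \<oplus> y \<in> \<phi> ` P" if "x \<in> \<phi> ` P" "y \<in> \<phi> ` P" for x y
      using that add assms(1) by (force simp: hom_add[symmetric] subset_iff)
  qed
  moreover have "x \<otimes> r \<in> \<phi> ` P" if xr: "x \<in> \<phi> ` P" "r \<in> carrier R" for x r
  proof -
    obtain p q where "p \<in> P" "x = \<phi> p" "q \<in> S" "r = \<phi> q"
      using xr image_S[symmetric] by auto
    then show ?thesis
      using mult[of p q] assms(1) by (auto simp: hom_mult[symmetric] subset_iff)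
  qed
  ultimately show ?thesis
    by (simp add: right_ideal_def additive_subgroup_def)
qed

lemma right_genideal_subset_image:
  assumes "P \<subseteq> S" "0 \<in> P" "G \<subseteq> \<phi> ` P"
    and "\<And>p q. p \<in> P \<Longrightarrow> q \<in> P \<Longrightarrow> p + q \<in> P"
    and "\<And>p q. p \<in> P \<Longrightarrow> q \<in> S \<Longrightarrow> p * q \<in> P"
  shows "right_genideal R G \<subseteq> \<phi> ` P"
  using right_ideal_image[OF assms(1,2,4,5)] assms(3) by (auto simp: right_genideal_def)

context
  fixes I assumes I: "right_ideal I R"
begin

lemma right_ideal_zero: "\<phi> 0 \<in> I"
  using I by (simp add: right_ideal_def hom_zero additive_subgroup.zero_closed)

lemma right_ideal_add: "p \<in> S \<Longrightarrow> q \<in> S \<Longrightarrow> \<phi> p \<in> I \<Longrightarrow> \<phi> q \<in> I \<Longrightarrow> \<phi> (p + q) \<in> I"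
  using I by (simp add: right_ideal_def hom_add additive_subgroup.a_closed)

lemma right_ideal_mult: "p \<in> S \<Longrightarrow> q \<in> S \<Longrightarrow> \<phi> p \<in> I \<Longrightarrow> \<phi> (p * q) \<in> I"
  using I by (simp add: right_ideal_def hom_mult hom_carrier)

lemma right_ideal_uminus: "p \<in> S \<Longrightarrow> \<phi> p \<in> I \<Longrightarrow> \<phi> (- p) \<in> I"
  using right_ideal_mult[of p "- 1"] by (simp add: uminus_S one_S)

lemma right_ideal_diff: "p \<in> S \<Longrightarrow> q \<in> S \<Longrightarrow> \<phi> p \<in> I \<Longrightarrow> \<phi> q \<in> I \<Longrightarrow> \<phi> (p - q) \<in> I"
  using right_ideal_add[of p "- q"] by (simp add: right_ideal_uminus uminus_S)

end

end


section \<open>Scalars in the free algebra\<close>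

abbreviation "\<sigma> \<equiv> gen Sig"
abbreviation "\<sigma>' \<equiv> gen Sig_star"
abbreviation "\<rho> \<equiv> gen Rho"
abbreviation "\<rho>' \<equiv> gen Rho_star"

text \<open>
  \<^const>\<open>scal\<close> is a central embedding of \<open>\<complex>((h))\<close>; below, scalars are always kept on the left.
\<close>

lemma scal_simps:
  "scal 0 = 0" "scal 1 = 1" "scal (c + d) = scal c + scal d" "scal (c - d) = scal c - scal d"
  "scal (- c) = - scal c" "scal (c * d) = scal c * scal d"
  by (simp_all add: single_add single_diff single_uminus mult_single single_one)

lemma scal_half_double: "scal (1/2) * (p + p) = p"
  by (simp add: distrib_left distrib_right[symmetric] scal_simps(2) flip: single_add)


section \<open>Triangular representations of the free algebra\<close>

text \<open>The linear extension to the free algebra of a function on words.\<close>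

definition lin :: "(word \<Rightarrow> complex fls) \<Rightarrow> free_alg \<Rightarrow> complex fls"
  where "lin F p = (\<Sum>u\<in>Poly_Mapping.keys p. poly_mapping.lookup p u * F u)"

lemma lin_superset:
  assumes "finite A" "Poly_Mapping.keys p \<subseteq> A"
  shows "lin F p = (\<Sum>u\<in>A. poly_mapping.lookup p u * F u)"
  unfolding lin_def using assms by (intro sum.mono_neutral_left) (auto simp: in_keys_iff)

lemma lin_zero [simp]: "lin F 0 = 0"
  by (simp add: lin_def)

lemma lin_add [simp]: "lin F (p + q) = lin F p + lin F q"
proof -
  have "Poly_Mapping.keys (p + q) \<subseteq> Poly_Mapping.keys p \<union> Poly_Mapping.keys q"
    by (rule Poly_Mapping.keys_add)
  then show ?thesis
    by (simp add: lin_superset[of "Poly_Mapping.keys p \<union> Poly_Mapping.keys q"] lookup_add distrib_right sum.distrib)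
qed

lemma lin_uminus [simp]: "lin F (- p) = - lin F p"
  using lin_add[of F p "- p"] by (simp add: eq_neg_iff_add_eq_0 add.commute)

lemma lin_diff [simp]: "lin F (p - q) = lin F p - lin F q"
  using lin_add[of F p "- q"] by simp

lemma lin_single [simp]: "lin F (Poly_Mapping.single u c) = c * F u"
  using lin_superset[of "{u}" "Poly_Mapping.single u c" F] by (simp add: lookup_single)

text \<open>A multiplication rule with two terms covers both characters and the twisted derivations below.\<close>

lemma lin_mult:
  assumes "\<And>u v. F (u + v) = A u * B v + C u * D v"
  shows "lin F (p * q) = lin A p * lin B q + lin C p * lin D q"
proof (induction p rule: free_alg_induct)
  case (2 u c p)
  have "lin F (Poly_Mapping.single u c * q) = c * A u * lin B q + c * C u * lin D q"
    by (induction q rule: free_alg_induct)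
      (simp_all add: distrib_left mult_single assms algebra_simps)
  with 2 show ?case
    by (simp add: algebra_simps)
qed simp

text \<open>
  For each \<open>s \<noteq> 0\<close> there is the character \<open>f\<^sub>s\<close> with \<open>\<sigma> \<mapsto> s\<^sup>-\<^sup>1\<close>, \<open>\<sigma>\<^sup>* \<mapsto> s\<close>, \<open>\<rho>, \<rho>\<^sup>* \<mapsto> 0\<close>;
  \<open>f\<^sub>1\<close> is the counit.
\<close>

fun char_letter :: "complex fls \<Rightarrow> letter \<Rightarrow> complex fls" where
  "char_letter s Sig = inverse s"
| "char_letter s Sig_star = s"
| "char_letter s Rho = 0"
| "char_letter s Rho_star = 0"

definition character :: "complex fls \<Rightarrow> free_alg \<Rightarrow> complex fls"
  where "character s = lin (\<lambda>u. prod_list (map (char_letter s) (letters u)))"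

text \<open>
  The upper right entry of the two-dimensional upper triangular representation that has diagonal
  \<open>(f\<^sub>1, f\<^sub>s)\<close> and upper right entry \<open>c x\<close> at the letter \<open>x\<close>.
\<close>

fun corner_word :: "complex fls \<Rightarrow> (letter \<Rightarrow> complex fls) \<Rightarrow> letter list \<Rightarrow> complex fls" where
  "corner_word s c [] = 0"
| "corner_word s c (x # xs) =
    char_letter 1 x * corner_word s c xs + c x * prod_list (map (char_letter s) xs)"

definition cocycle :: "complex fls \<Rightarrow> (letter \<Rightarrow> complex fls) \<Rightarrow> free_alg \<Rightarrow> complex fls"
  where "cocycle s c = lin (\<lambda>u. corner_word s c (letters u))"

lemma corner_word_append:
  "corner_word s c (xs @ ys) =
    prod_list (map (char_letter 1) xs) * corner_word s c ys +
    corner_word s c xs * prod_list (map (char_letter s) ys)"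
  by (induction xs) (simp_all add: algebra_simps)

lemma character_simps [simp]:
  "character s (p + q) = character s p + character s q"
  "character s (p - q) = character s p - character s q"
  "character s (- p) = - character s p"
  "character s (p * q) = character s p * character s q"
  "character s 0 = 0" "character s 1 = 1" "character s (scal c) = c"
  "character s (gen x) = char_letter s x"
  unfolding character_def gen_def
  by (simp_all add: lin_mult[of _ _ _ "\<lambda>_. 0" "\<lambda>_. 0"] plus_word_def zero_word_def
      single_one[symmetric])
    (simp add: lin_def)

lemma cocycle_simps [simp]:
  "cocycle s c (p + q) = cocycle s c p + cocycle s c q"
  "cocycle s c (p - q) = cocycle s c p - cocycle s c q"
  "cocycle s c (- p) = - cocycle s c p"
  "cocycle s c (p * q) = character 1 p * cocycle s c q + cocycle s c p * character s q"
  "cocycle s c 0 = 0" "cocycle s c 1 = 0" "cocycle s c (scal d) = 0"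
  "cocycle s c (gen x) = c x"
proof -
  show "cocycle s c (p * q) = character 1 p * cocycle s c q + cocycle s c p * character s q"
    unfolding cocycle_def character_def
    by (rule lin_mult) (simp add: plus_word_def corner_word_append)
qed (simp_all add: cocycle_def gen_def zero_word_def single_one[symmetric] del: single_one)

section \<open>Power series among Laurent series\<close>

text \<open>
  \<open>\<complex>[[h]]\<close> as a subring of \<open>\<complex>((h))\<close>.  On it, the coefficient of \<open>h\<^sup>0\<close> is a ring homomorphism.
\<close>

definition PS :: "complex fls set" where "PS = range fps_to_fls"

lemma PS_closed:
  "0 \<in> PS" "1 \<in> PS" "numeral n \<in> PS" "fls_const z \<in> PS" "fls_X \<in> PS"
  "c \<in> PS \<Longrightarrow> d \<in> PS \<Longrightarrow> c + d \<in> PS" "c \<in> PS \<Longrightarrow> d \<in> PS \<Longrightarrow> c - d \<in> PS"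
  "c \<in> PS \<Longrightarrow> - c \<in> PS" "c \<in> PS \<Longrightarrow> d \<in> PS \<Longrightarrow> c * d \<in> PS"
proof -
  have fps: "fps_to_fls f \<in> PS" for f
    by (simp add: PS_def)
  show "0 \<in> PS" "1 \<in> PS" "numeral n \<in> PS" "fls_const z \<in> PS" "fls_X \<in> PS"
    using fps[of 0] fps[of 1] fps[of "numeral n"] fps[of "fps_const z"] fps[of fps_X] by simp_all
  show "c \<in> PS \<Longrightarrow> d \<in> PS \<Longrightarrow> c + d \<in> PS" "c \<in> PS \<Longrightarrow> d \<in> PS \<Longrightarrow> c - d \<in> PS"
    "c \<in> PS \<Longrightarrow> - c \<in> PS" "c \<in> PS \<Longrightarrow> d \<in> PS \<Longrightarrow> c * d \<in> PS"
    unfolding PS_def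
    by (auto simp: image_iff simp flip: fps_to_fls_plus fps_to_fls_minus fps_to_fls_uminus
        fls_times_fps_to_fls)
qed

lemma half_fls: "(1/2 :: complex fls) = fls_const (1/2)"
  using fls_const_divide_const[of 1 "2 :: complex"] by simp

lemma PS_half: "1/2 \<in> PS" "fls_nth (1/2 :: complex fls) 0 = 1/2"
  by (simp only: half_fls PS_closed) (subst half_fls, simp)

lemma PS_nth_mult: "c \<in> PS \<Longrightarrow> d \<in> PS \<Longrightarrow> fls_nth (c * d) 0 = fls_nth c 0 * fls_nth d 0"
  by (auto simp: PS_def fls_times_fps_to_fls[symmetric])

lemma PS_inverse:
  assumes "c \<in> PS" "fls_nth c 0 \<noteq> 0"
  shows "inverse c \<in> PS" "fls_nth (inverse c) 0 = inverse (fls_nth c 0)"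
proof -
  obtain f where f: "c = fps_to_fls f"
    using assms(1) by (auto simp: PS_def)
  then have "inverse c = fps_to_fls (inverse f)"
    using assms(2) by (simp add: fls_inverse_fps_to_fls)
  then show "inverse c \<in> PS" "fls_nth (inverse c) 0 = inverse (fls_nth c 0)"
    using f by (auto simp: PS_def)
qed

lemma PS_divide_X:
  assumes "c \<in> PS" "fls_nth c 0 = 0"
  obtains d where "d \<in> PS" "c = fls_X * d" "fls_nth d 0 = fls_nth c 1"
proof -
  obtain f where f: "c = fps_to_fls f"
    using assms(1) by (auto simp: PS_def)
  have "f = fps_X * Abs_fps (\<lambda>n. fps_nth f (Suc n))"
    using assms(2) by (auto simp: fps_eq_iff f gr0_conv_Suc)
  then have "c = fls_X * fps_to_fls (Abs_fps (\<lambda>n. fps_nth f (Suc n)))"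
    by (metis f fls_times_fps_to_fls fps_X_to_fls)
  then show ?thesis
    by (rule that[rotated]) (simp_all add: PS_def f)
qed

lemma X_inv_X: "fls_X_inv * fls_X = (1 :: complex fls)" "fls_X * fls_X_inv = (1 :: complex fls)"
  by (simp_all flip: fls_inverse_X)


section \<open>Spans modulo a subgroup\<close>

text \<open>
  The set \<open>P + C + C x + C y + C z\<close>, for a ring \<open>C\<close> of scalars and a \<open>C\<close>-submodule \<open>P\<close>.  It occurs once
  with \<open>C = \<complex>((h))\<close> and \<open>P\<close> the Woronowicz ideal, and once with \<open>C = \<complex>\<close> and \<open>P\<close> the ideal of the
  limit.
\<close>

locale coset_span =
  fixes C :: "complex fls set" and P :: "free_alg set" and x y z :: free_alg
  assumes C_zero: "0 \<in> C" and C_one: "1 \<in> C"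
    and C_add: "c \<in> C \<Longrightarrow> d \<in> C \<Longrightarrow> c + d \<in> C"
    and C_mult: "c \<in> C \<Longrightarrow> d \<in> C \<Longrightarrow> c * d \<in> C"
    and P_zero: "0 \<in> P"
    and P_add: "p \<in> P \<Longrightarrow> q \<in> P \<Longrightarrow> p + q \<in> P"
    and P_scal: "c \<in> C \<Longrightarrow> p \<in> P \<Longrightarrow> scal c * p \<in> P"
begin

definition span :: "free_alg set" where
  "span = {p. \<exists>c0\<in>C. \<exists>c1\<in>C. \<exists>c2\<in>C. \<exists>c3\<in>C.
    p - (scal c0 + scal c1 * x + scal c2 * y + scal c3 * z) \<in> P}"

lemma spanI:
  assumes "p - (scal c0 + scal c1 * x + scal c2 * y + scal c3 * z) \<in> P"
    and "c0 \<in> C" "c1 \<in> C" "c2 \<in> C" "c3 \<in> C"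
  shows "p \<in> span"
  using assms by (auto simp: span_def)

lemma spanE:
  assumes "p \<in> span"
  obtains c0 c1 c2 c3 where "c0 \<in> C" "c1 \<in> C" "c2 \<in> C" "c3 \<in> C"
    "p - (scal c0 + scal c1 * x + scal c2 * y + scal c3 * z) \<in> P"
  using assms by (auto simp: span_def)

lemma span_P: "p \<in> P \<Longrightarrow> p \<in> span"
  by (rule spanI[of _ 0 0 0 0]) (simp_all add: C_zero)

lemma span_basis: "1 \<in> span" "x \<in> span" "y \<in> span" "z \<in> span"
  by (rule spanI[of _ 1 0 0 0] spanI[of _ 0 1 0 0] spanI[of _ 0 0 1 0] spanI[of _ 0 0 0 1];
      simp add: C_zero C_one P_zero)+

lemma span_add:
  assumes "p \<in> span" "q \<in> span" shows "p + q \<in> span"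
proof -
  obtain c0 c1 c2 c3 where c: "c0 \<in> C" "c1 \<in> C" "c2 \<in> C" "c3 \<in> C"
      "p - (scal c0 + scal c1 * x + scal c2 * y + scal c3 * z) \<in> P"
    using assms(1) by (rule spanE)
  obtain d0 d1 d2 d3 where d: "d0 \<in> C" "d1 \<in> C" "d2 \<in> C" "d3 \<in> C"
      "q - (scal d0 + scal d1 * x + scal d2 * y + scal d3 * z) \<in> P"
    using assms(2) by (rule spanE)
  show ?thesis
    by (rule spanI[of _ "c0 + d0" "c1 + d1" "c2 + d2" "c3 + d3"])
      (use P_add[OF c(5) d(5)] c d in \<open>simp_all add: C_add scal_simps algebra_simps\<close>)
qed

lemma span_scal:
  assumes "p \<in> span" "c \<in> C" shows "scal c * p \<in> span"
proof -
  obtain c0 c1 c2 c3 where c: "c0 \<in> C" "c1 \<in> C" "c2 \<in> C" "c3 \<in> C"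
      "p - (scal c0 + scal c1 * x + scal c2 * y + scal c3 * z) \<in> P"
    using assms(1) by (rule spanE)
  show ?thesis
    by (rule spanI[of _ "c * c0" "c * c1" "c * c2" "c * c3"])
      (use P_scal[OF assms(2) c(5)] c assms(2)
        in \<open>simp_all add: C_mult scal_simps(6) distrib_left right_diff_distrib mult.assoc\<close>)
qed

lemma span_diff:
  assumes "- 1 \<in> C" "p \<in> span" "q \<in> span" shows "p - q \<in> span"
  using span_add[OF assms(2) span_scal[OF assms(3,1)]] by (simp add: scal_simps)

lemma span_mult_right:
  assumes "p \<in> span" "\<And>q. q \<in> P \<Longrightarrow> q * r \<in> P"
    and "r \<in> span" "x * r \<in> span" "y * r \<in> span" "z * r \<in> span"
  shows "p * r \<in> span"
proof -
  obtain c0 c1 c2 c3 where c: "c0 \<in> C" "c1 \<in> C" "c2 \<in> C" "c3 \<in> C"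
      "p - (scal c0 + scal c1 * x + scal c2 * y + scal c3 * z) \<in> P"
    using assms(1) by (rule spanE)
  have "p * r = (p - (scal c0 + scal c1 * x + scal c2 * y + scal c3 * z)) * r +
      (scal c0 * r + scal c1 * (x * r) + scal c2 * (y * r) + scal c3 * (z * r))"
    by (simp add: distrib_right left_diff_distrib mult.assoc)
  also have "\<dots> \<in> span"
    by (intro span_add span_scal span_P[OF assms(2)[OF c(5)]] assms(3-6) c(1-4))
  finally show ?thesis .
qed

end

context
  fixes \<kappa> :: real
begin


section \<open>The defining ideal\<close>

lemma kernel_closed:
  shows kernel_zero: "0 \<in> su_kernel \<kappa>"
    and kernel_add: "\<And>p q. p \<in> su_kernel \<kappa> \<Longrightarrow> q \<in> su_kernel \<kappa> \<Longrightarrow> p + q \<in> su_kernel \<kappa>"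
    and kernel_mult_right: "\<And>p q. p \<in> su_kernel \<kappa> \<Longrightarrow> p * q \<in> su_kernel \<kappa>"
    and kernel_mult_left: "\<And>p q. p \<in> su_kernel \<kappa> \<Longrightarrow> q * p \<in> su_kernel \<kappa>"
    and kernel_uminus: "\<And>p. p \<in> su_kernel \<kappa> \<Longrightarrow> - p \<in> su_kernel \<kappa>"
    and kernel_diff: "\<And>p q. p \<in> su_kernel \<kappa> \<Longrightarrow> q \<in> su_kernel \<kappa> \<Longrightarrow> p - q \<in> su_kernel \<kappa>"
proof -
  interpret K: ideal "su_kernel \<kappa>" free_ring by (rule ideal_su_kernel)
  show "0 \<in> su_kernel \<kappa>"
    using additive_subgroup.zero_closed[OF K.additive_subgroup_axioms] by (simp add: free_ring_def)
  show add: "p + q \<in> su_kernel \<kappa>" if "p \<in> su_kernel \<kappa>" "q \<in> su_kernel \<kappa>" for p q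
    using additive_subgroup.a_closed[OF K.additive_subgroup_axioms that] by (simp add: free_ring_def)
  show mult: "p * q \<in> su_kernel \<kappa>" "q * p \<in> su_kernel \<kappa>" if "p \<in> su_kernel \<kappa>" for p q
    using K.I_l_closed[OF that, of q] K.I_r_closed[OF that, of q] by (simp_all add: free_ring_def)
  show neg: "- p \<in> su_kernel \<kappa>" if "p \<in> su_kernel \<kappa>" for p
    using mult(1)[OF that, of "- 1"] by simp
  show "p - q \<in> su_kernel \<kappa>" if "p \<in> su_kernel \<kappa>" "q \<in> su_kernel \<kappa>" for p q
    using add[OF that(1) neg[OF that(2)]] by simp
qed

lemma su_class_one: "su_class \<kappa> 1 = \<one>\<^bsub>SU \<kappa>\<^esub>"
  using ring_hom_one[OF su_class_hom] by (simp add: free_ring_def)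

lemma su_class_add: "su_class \<kappa> (p + q) = su_class \<kappa> p \<oplus>\<^bsub>SU \<kappa>\<^esub> su_class \<kappa> q"
  using ring_hom_add[OF su_class_hom, of p q] by (simp add: free_ring_def)

lemma su_class_mult: "su_class \<kappa> (p * q) = su_class \<kappa> p \<otimes>\<^bsub>SU \<kappa>\<^esub> su_class \<kappa> q"
  using ring_hom_mult[OF su_class_hom, of p q] by (simp add: free_ring_def)

lemma carrier_SU: "carrier (SU \<kappa>) = range (su_class \<kappa>)"
  by (auto simp: SU_def FactRing_def A_RCOSETS_def RCOSETS_def su_class_def a_r_coset_def)

interpretation SU: ring_presentation UNIV "su_class \<kappa>" "SU \<kappa>"
  by (rule ring_presentation.intro)
    (simp_all add: carrier_SU su_class_one su_class_add su_class_mult ring_SU)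

lemma su_class_eq_iff: "su_class \<kappa> p = su_class \<kappa> q \<longleftrightarrow> p - q \<in> su_kernel \<kappa>"
proof -
  have cl: "su_class \<kappa> p = (\<lambda>k. k + p) ` su_kernel \<kappa>" for p
    by (auto simp: su_class_def a_r_coset_def r_coset_def free_ring_def)
  show ?thesis
  proof
    assume "su_class \<kappa> p = su_class \<kappa> q"
    then have "0 + p \<in> (\<lambda>k. k + q) ` su_kernel \<kappa>"
      using kernel_zero unfolding cl by blast
    then show "p - q \<in> su_kernel \<kappa>"
      by auto
  next
    assume *: "p - q \<in> su_kernel \<kappa>"
    have "k + p \<in> (\<lambda>k. k + q) ` su_kernel \<kappa>" if "k \<in> su_kernel \<kappa>" for k
      using kernel_add[OF that *] by (auto intro!: image_eqI[of _ _ "k + (p - q)"])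
    moreover have "k + q \<in> (\<lambda>k. k + p) ` su_kernel \<kappa>" if "k \<in> su_kernel \<kappa>" for k
      using kernel_diff[OF that *] by (auto intro!: image_eqI[of _ _ "k - (p - q)"])
    ultimately show "su_class \<kappa> p = su_class \<kappa> q"
      unfolding cl by blast
  qed
qed

text \<open>The defining relations, separated into those for \<open>\<rho>\<close> and for \<open>\<rho>\<^sup>*\<close>, and their adjoints.\<close>

lemma relations_in_kernel:
  fixes m :: free_alg
  defines "m \<equiv> scal (mu \<kappa>)"
  shows "\<rho> * \<rho>' - \<rho>' * \<rho> \<in> su_kernel \<kappa>"
    and "\<sigma> * \<rho> - m * (\<rho> * \<sigma>) \<in> su_kernel \<kappa>"
    and "\<sigma> * \<rho>' - m * (\<rho>' * \<sigma>) \<in> su_kernel \<kappa>"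
    and "\<rho> * \<sigma>' - m * (\<sigma>' * \<rho>) \<in> su_kernel \<kappa>"
    and "\<rho>' * \<sigma>' - m * (\<sigma>' * \<rho>') \<in> su_kernel \<kappa>"
    and "\<sigma> * \<sigma>' + m * m * (\<rho> * \<rho>') - 1 \<in> su_kernel \<kappa>"
    and "\<sigma>' * \<sigma> + \<rho> * \<rho>' - 1 \<in> su_kernel \<kappa>"
proof -
  have S: "su_relations \<kappa> \<union> free_star ` su_relations \<kappa> \<subseteq> su_kernel \<kappa>"
    unfolding su_kernel_def by (rule ring.genideal_self[OF ring_free_ring]) simp
  have halves: "p \<in> su_kernel \<kappa> \<and> q \<in> su_kernel \<kappa>"
    if "p - q \<in> su_kernel \<kappa>" "p + q \<in> su_kernel \<kappa>" for p q
  proof -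
    have half: "x \<in> su_kernel \<kappa>" if "x + x \<in> su_kernel \<kappa>" for x
      using kernel_mult_left[OF that, of "scal (1/2)"] by (simp only: scal_half_double)
    show ?thesis
      using kernel_add[OF that] kernel_diff[OF that(2,1)] half[of p] half[of q]
      by (simp add: algebra_simps)
  qed
  have star: "free_star m = m"
    by (simp add: m_def)
  have comm: "p * m = m * p" for p
    by (simp add: m_def scal_commute)
  have r: "m * (\<rho> - \<rho>') * \<sigma> - \<sigma> * (\<rho> - \<rho>') \<in> su_relations \<kappa>"
    "m * (\<rho> + \<rho>') * \<sigma> - \<sigma> * (\<rho> + \<rho>') \<in> su_relations \<kappa>"
    "\<rho> * \<rho>' - \<rho>' * \<rho> \<in> su_relations \<kappa>"
    "\<sigma> * \<sigma>' + m^2 * \<rho> * \<rho>' - 1 \<in> su_relations \<kappa>"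
    "\<sigma>' * \<sigma> + \<rho> * \<rho>' - 1 \<in> su_relations \<kappa>"
    by (simp_all add: su_relations_def Let_def m_def)
  show "\<rho> * \<rho>' - \<rho>' * \<rho> \<in> su_kernel \<kappa>" "\<sigma>' * \<sigma> + \<rho> * \<rho>' - 1 \<in> su_kernel \<kappa>"
    using r S by blast+
  show "\<sigma> * \<sigma>' + m * m * (\<rho> * \<rho>') - 1 \<in> su_kernel \<kappa>"
    using r(4) S by (auto simp: power2_eq_square mult.assoc)
  have "m * (\<rho> * \<sigma>) - \<sigma> * \<rho> \<in> su_kernel \<kappa> \<and> m * (\<rho>' * \<sigma>) - \<sigma> * \<rho>' \<in> su_kernel \<kappa>"
    using r(1,2) S by (intro halves) (auto simp: algebra_simps)
  then show "\<sigma> * \<rho> - m * (\<rho> * \<sigma>) \<in> su_kernel \<kappa>" "\<sigma> * \<rho>' - m * (\<rho>' * \<sigma>) \<in> su_kernel \<kappa>"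
    using kernel_uminus by (metis minus_diff_eq)+
  have "free_star (m * (\<rho> - \<rho>') * \<sigma> - \<sigma> * (\<rho> - \<rho>')) \<in> su_kernel \<kappa>"
    "free_star (m * (\<rho> + \<rho>') * \<sigma> - \<sigma> * (\<rho> + \<rho>')) \<in> su_kernel \<kappa>"
    using r(1,2) S by blast+
  moreover have "free_star (m * (\<rho> - \<rho>') * \<sigma> - \<sigma> * (\<rho> - \<rho>')) =
      (\<rho> * \<sigma>' - m * (\<sigma>' * \<rho>)) - (\<rho>' * \<sigma>' - m * (\<sigma>' * \<rho>'))"
    by (simp add: free_star_mult free_star_diff free_star_add star algebra_simps comm)
  moreover have "- free_star (m * (\<rho> + \<rho>') * \<sigma> - \<sigma> * (\<rho> + \<rho>')) =
      (\<rho> * \<sigma>' - m * (\<sigma>' * \<rho>)) + (\<rho>' * \<sigma>' - m * (\<sigma>' * \<rho>'))"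
    by (simp add: free_star_mult free_star_diff free_star_add star algebra_simps comm)
  ultimately show "\<rho> * \<sigma>' - m * (\<sigma>' * \<rho>) \<in> su_kernel \<kappa>" "\<rho>' * \<sigma>' - m * (\<sigma>' * \<rho>') \<in> su_kernel \<kappa>"
    using halves kernel_uminus by metis+
qed



section \<open>Functionals vanishing on the defining ideal\<close>

lemma kernel_minimal:
  assumes "su_relations \<kappa> \<union> free_star ` su_relations \<kappa> \<subseteq> P" "0 \<in> P"
    and add: "\<And>p q. p \<in> P \<Longrightarrow> q \<in> P \<Longrightarrow> p + q \<in> P"
    and mult: "\<And>p q. p \<in> P \<Longrightarrow> p * q \<in> P" "\<And>p q. p \<in> P \<Longrightarrow> q * p \<in> P"
  shows "su_kernel \<kappa> \<subseteq> P"
proof -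
  interpret F: ring free_ring by (rule ring_free_ring)
  have "ideal P free_ring"
  proof (rule idealI[OF ring_free_ring])
    show "subgroup P (add_monoid free_ring)"
    proof (rule F.add.subgroupI)
      fix p assume p: "p \<in> P"
      have "- p \<oplus>\<^bsub>free_ring\<^esub> p = \<zero>\<^bsub>free_ring\<^esub>" by (simp add: free_ring_def)
      then have "\<ominus>\<^bsub>free_ring\<^esub> p = - p"
        by (simp add: F.minus_equality)
      then show "\<ominus>\<^bsub>free_ring\<^esub> p \<in> P"
        using mult(1)[OF p, of "- 1"] by simp
    qed (use assms in \<open>auto simp: free_ring_def\<close>)
  qed (use mult in \<open>auto simp: free_ring_def\<close>)
  then show ?thesis
    unfolding su_kernel_def using assms(1) by (rule F.genideal_minimal)
qed

lemma mu_nonzero [simp]: "mu \<kappa> \<noteq> 0"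
  by (auto simp: mu_def fps_eq_iff)

lemma all_relations:
  fixes m :: free_alg
  defines "m \<equiv> scal (mu \<kappa>)"
  shows "su_relations \<kappa> \<union> free_star ` su_relations \<kappa> =
    {\<rho> * \<rho>' - \<rho>' * \<rho>, m * (\<rho> - \<rho>') * \<sigma> - \<sigma> * (\<rho> - \<rho>'), m * (\<rho> + \<rho>') * \<sigma> - \<sigma> * (\<rho> + \<rho>'),
     \<sigma> * \<sigma>' + m * m * \<rho> * \<rho>' - 1, \<sigma>' * \<sigma> + \<rho> * \<rho>' - 1,
     \<sigma>' * ((\<rho>' - \<rho>) * m) - (\<rho>' - \<rho>) * \<sigma>', \<sigma>' * ((\<rho>' + \<rho>) * m) - (\<rho>' + \<rho>) * \<sigma>',
     \<sigma> * \<sigma>' + \<rho> * (\<rho>' * (m * m)) - 1}"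
proof -
  have "free_star 1 = 1"
    using free_star_scal[of 1] by simp
  then show ?thesis
    by (simp add: su_relations_def Let_def m_def free_star_mult free_star_diff free_star_add
        power2_eq_square insert_commute)
qed

lemma kernel_functionals_zero:
  assumes "s \<noteq> 0" "\<forall>r\<in>su_relations \<kappa> \<union> free_star ` su_relations \<kappa>. cocycle s c r = 0"
    and "p \<in> su_kernel \<kappa>"
  shows "character s p = 0" "cocycle s c p = 0"
proof -
  let ?P = "{p. character 1 p = 0 \<and> character s p = 0 \<and> cocycle s c p = 0}"
  have "su_kernel \<kappa> \<subseteq> ?P"
    by (rule kernel_minimal) (use assms(1,2) in \<open>auto simp: all_relations\<close>)
  then show "character s p = 0" "cocycle s c p = 0"
    using assms(3) by auto
qed

text \<open>
  The coordinates of an element of \<open>A / I\<close> with respect to the basis \<open>1, \<rho>, T, V\<close> with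
  \<open>T = (\<rho> + \<rho>\<^sup>*) / h\<close> and \<open>V = (\<sigma> - 1) / h\<close>; the coordinate at \<open>1\<close> is the counit.  In this basis
  \<open>\<rho>\<^sup>* = h T - \<rho>\<close>, \<open>\<sigma> = 1 + h V\<close> and \<open>\<sigma>\<^sup>* = 1 - \<mu>\<^sup>2 h V\<close>, and therefore \<open>U = (\<sigma> - \<sigma>\<^sup>*) / h\<close> is \<open>(1 + \<mu>\<^sup>2) V\<close>.
  Unlike \<open>V\<close>, the element \<open>U\<close> is visibly a member of the \<open>\<complex>[[h]]\<close>-subalgebra, which is why the
  coordinate is named after it.
\<close>

definition coord_rho :: "free_alg \<Rightarrow> complex fls" where
  "coord_rho = cocycle (mu \<kappa>) (\<lambda>x. case x of Rho \<Rightarrow> 1 | Rho_star \<Rightarrow> - 1 | _ \<Rightarrow> 0)"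

definition coord_T :: "free_alg \<Rightarrow> complex fls" where
  "coord_T = cocycle (mu \<kappa>) (\<lambda>x. case x of Rho_star \<Rightarrow> fls_X | _ \<Rightarrow> 0)"

definition coord_U :: "free_alg \<Rightarrow> complex fls" where
  "coord_U = cocycle (mu \<kappa> * mu \<kappa>)
    (\<lambda>x. case x of Sig \<Rightarrow> fls_X | Sig_star \<Rightarrow> - (fls_X * (mu \<kappa> * mu \<kappa>)) | _ \<Rightarrow> 0)"

lemmas coord_defs = coord_rho_def coord_T_def coord_U_def

lemma kernel_coords_zero:
  assumes "p \<in> su_kernel \<kappa>"
  shows "character 1 p = 0" "character (mu \<kappa>) p = 0" "character (mu \<kappa> * mu \<kappa>) p = 0"
    "coord_rho p = 0" "coord_T p = 0" "coord_U p = 0"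
proof -
  show "character 1 p = 0"
    by (rule kernel_functionals_zero(1)[OF _ _ assms, of _ "\<lambda>_. 0"]) (auto simp: all_relations)
  show "character (mu \<kappa>) p = 0" "character (mu \<kappa> * mu \<kappa>) p = 0"
    by (rule kernel_functionals_zero(1)[OF _ _ assms, of _ "\<lambda>_. 0"]; simp add: all_relations)+
  show "coord_rho p = 0"
    unfolding coord_defs
    by (rule kernel_functionals_zero(2)[OF _ _ assms]) (auto simp: all_relations field_simps)
  show "coord_T p = 0"
    unfolding coord_defs
    by (rule kernel_functionals_zero(2)[OF _ _ assms]) (auto simp: all_relations field_simps)
  show "coord_U p = 0"
    unfolding coord_defs
    by (rule kernel_functionals_zero(2)[OF _ _ assms]) (auto simp: all_relations field_simps)
qed



section \<open>Coordinates modulo the Woronowicz ideal\<close>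

text \<open>The representatives of the elements of the Woronowicz ideal.\<close>

definition worono :: "free_alg set"
  where "worono = {p. su_class \<kappa> p \<in> woronowicz_ideal \<kappa>}"

lemma worono_closed:
  shows worono_zero: "0 \<in> worono"
    and worono_add: "p \<in> worono \<Longrightarrow> q \<in> worono \<Longrightarrow> p + q \<in> worono"
    and worono_diff: "p \<in> worono \<Longrightarrow> q \<in> worono \<Longrightarrow> p - q \<in> worono"
    and worono_mult: "p \<in> worono \<Longrightarrow> p * q \<in> worono"
    and worono_scal: "p \<in> worono \<Longrightarrow> scal c * p \<in> worono"
    and worono_kernel: "p \<in> su_kernel \<kappa> \<Longrightarrow> p \<in> worono"
    and worono_generators: "\<rho> * \<rho> \<in> worono" "\<rho>' * \<rho>' \<in> worono" "\<rho>' * \<rho> \<in> worono"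
      "(\<sigma> - 1) * (\<rho> - \<rho>') \<in> worono" "(\<sigma> - 1) * (\<rho> + \<rho>') \<in> worono"
      "\<sigma>' + scal (mu \<kappa>) * scal (mu \<kappa>) * \<sigma> - (1 + scal (mu \<kappa>) * scal (mu \<kappa>)) \<in> worono"
proof -
  define G where "G = {\<rho>\<^sup>2, \<rho>'\<^sup>2, \<rho>' * \<rho>, (\<sigma> - 1) * (\<rho> - \<rho>'), (\<sigma> - 1) * (\<rho> + \<rho>'),
    \<sigma>' + (scal (mu \<kappa>))\<^sup>2 * \<sigma> - (1 + (scal (mu \<kappa>))\<^sup>2)}"
  have W: "woronowicz_ideal \<kappa> = right_genideal (SU \<kappa>) (su_class \<kappa> ` G)"
    by (simp add: woronowicz_ideal_def Let_def G_def)
  have G: "su_class \<kappa> ` G \<subseteq> carrier (SU \<kappa>)"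
    using su_class_carrier by blast
  note I = right_ideal_right_genideal[OF ring_SU G, folded W]
  show "0 \<in> worono" "p \<in> worono \<Longrightarrow> q \<in> worono \<Longrightarrow> p + q \<in> worono"
    "p \<in> worono \<Longrightarrow> q \<in> worono \<Longrightarrow> p - q \<in> worono"
    using SU.right_ideal_zero[OF I(1)] SU.right_ideal_add[OF I(1)] SU.right_ideal_diff[OF I(1)]
    by (simp_all add: worono_def)
  show mult: "p \<in> worono \<Longrightarrow> p * q \<in> worono" for p q
    using SU.right_ideal_mult[OF I(1)] by (simp add: worono_def)
  show "p \<in> worono \<Longrightarrow> scal c * p \<in> worono"
    using mult[of p "scal c"] by (simp add: scal_commute)
  show "p \<in> su_kernel \<kappa> \<Longrightarrow> p \<in> worono"
    using SU.right_ideal_zero[OF I(1)] su_class_eq_iff[of p 0] by (simp add: worono_def)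
  have "G \<subseteq> worono"
    using I(2) by (auto simp: worono_def)
  then show "\<rho> * \<rho> \<in> worono" "\<rho>' * \<rho>' \<in> worono" "\<rho>' * \<rho> \<in> worono"
      "(\<sigma> - 1) * (\<rho> - \<rho>') \<in> worono" "(\<sigma> - 1) * (\<rho> + \<rho>') \<in> worono"
      "\<sigma>' + scal (mu \<kappa>) * scal (mu \<kappa>) * \<sigma> - (1 + scal (mu \<kappa>) * scal (mu \<kappa>)) \<in> worono"
    by (simp_all add: G_def power2_eq_square)
qed

lemma worono_coords_zero:
  assumes "p \<in> worono"
  shows "character 1 p = 0 \<and> coord_rho p = 0 \<and> coord_T p = 0 \<and> coord_U p = 0"
proof -
  let ?P = "{p. character 1 p = 0 \<and> coord_rho p = 0 \<and> coord_T p = 0 \<and> coord_U p = 0}"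
  have "woronowicz_ideal \<kappa> \<subseteq> su_class \<kappa> ` ?P"
    unfolding woronowicz_ideal_def Let_def
    by (rule SU.right_genideal_subset_image)
      (auto simp: coord_defs power2_eq_square intro!: image_mono)
  then obtain q where q: "q \<in> ?P" "su_class \<kappa> p = su_class \<kappa> q"
    using assms by (auto simp: worono_def)
  then have "p - q \<in> su_kernel \<kappa>"
    by (simp add: su_class_eq_iff)
  from kernel_coords_zero[OF this] q(1) show ?thesis
    by (simp add: coord_defs)
qed

interpretation WS: coset_span UNIV worono \<rho> \<rho>' \<sigma>
  by unfold_locales (simp_all add: worono_zero worono_add worono_scal)

text \<open>
  The quotient by the Woronowicz ideal is spanned by \<open>1, \<rho>, \<rho>\<^sup>*, \<sigma>\<close>, since modulo the ideal
  \<open>\<sigma> \<rho> = \<rho>\<close>, \<open>\<rho> \<sigma> = \<mu>\<^sup>-\<^sup>1 \<rho>\<close>, \<open>\<rho> \<sigma>\<^sup>* = \<mu> \<rho>\<close>, likewise for \<open>\<rho>\<^sup>*\<close>, and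
  \<open>\<sigma> \<sigma>\<^sup>* = \<sigma>\<^sup>* \<sigma> = 1\<close>, \<open>(\<mu>\<^sup>2 \<sigma> - 1) (\<sigma> - 1) = 0\<close>.
\<close>

lemma worono_span: "p \<in> WS.span"
proof -
  define m where "m = scal (mu \<kappa>)"
  define n where "n = scal (inverse (mu \<kappa>))"
  have nm: "n * m = 1" "n * (m * q) = q" for q
    by (simp_all add: n_def m_def scal_simps(6)[symmetric] scal_simps(2) mult.assoc[symmetric])
  note K = relations_in_kernel[folded m_def, THEN worono_kernel]
  note W = worono_generators[folded m_def]
  note scal = worono_scal[of _ "mu \<kappa>", folded m_def] worono_scal[of _ "inverse (mu \<kappa>)", folded n_def]
  have \<rho>\<rho>': "\<rho> * \<rho>' \<in> worono"
    using worono_add[OF K(1) W(3)] by simp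
  have sum: "(\<sigma> - 1) * \<rho> + (\<sigma> - 1) * \<rho> \<in> worono" "(\<sigma> - 1) * \<rho>' + (\<sigma> - 1) * \<rho>' \<in> worono"
    using worono_add[OF W(5,4)] worono_diff[OF W(5,4)] by (simp_all add: algebra_simps)
  have \<sigma>\<rho>: "\<sigma> * \<rho> - \<rho> \<in> worono" "\<sigma> * \<rho>' - \<rho>' \<in> worono"
    using worono_scal[OF sum(1), of "1/2"] worono_scal[OF sum(2), of "1/2"]
    by (simp_all only: scal_half_double) (simp_all add: left_diff_distrib)
  have \<rho>\<sigma>: "\<rho> * \<sigma> - n * \<rho> \<in> worono" "\<rho>' * \<sigma> - n * \<rho>' \<in> worono"
    using scal(2)[OF worono_diff[OF \<sigma>\<rho>(1) K(2)]] scal(2)[OF worono_diff[OF \<sigma>\<rho>(2) K(3)]]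
    by (simp_all add: right_diff_distrib nm)
  have \<sigma>'\<rho>: "\<sigma>' * \<rho> - \<rho> \<in> worono" "\<sigma>' * \<rho>' - \<rho>' \<in> worono"
    using worono_diff[OF worono_mult[OF W(6), of \<rho>] scal(1)[OF scal(1)[OF \<sigma>\<rho>(1)]]]
      worono_diff[OF worono_mult[OF W(6), of \<rho>'] scal(1)[OF scal(1)[OF \<sigma>\<rho>(2)]]]
    by (simp_all add: algebra_simps)
  have \<rho>\<sigma>': "\<rho> * \<sigma>' - m * \<rho> \<in> worono" "\<rho>' * \<sigma>' - m * \<rho>' \<in> worono"
    using worono_add[OF K(4) scal(1)[OF \<sigma>'\<rho>(1)]] worono_add[OF K(5) scal(1)[OF \<sigma>'\<rho>(2)]]
    by (simp_all add: right_diff_distrib)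
  have \<sigma>\<sigma>': "\<sigma> * \<sigma>' - 1 \<in> worono"
    using worono_diff[OF K(6) scal(1)[OF scal(1)[OF \<rho>\<rho>']]] by (simp add: algebra_simps)
  have \<sigma>'\<sigma>: "\<sigma>' * \<sigma> - 1 \<in> worono"
    using worono_diff[OF K(7) \<rho>\<rho>'] by (simp add: algebra_simps)
  have "m * (m * (\<sigma> * \<sigma>)) - (\<sigma> + m * (m * \<sigma>) - 1) \<in> worono"
    using worono_diff[OF worono_mult[OF W(6), of \<sigma>] \<sigma>'\<sigma>] by (simp add: algebra_simps)
  from scal(2)[OF scal(2)[OF this]]
  have \<sigma>\<sigma>: "\<sigma> * \<sigma> - (n * (n * \<sigma>) + \<sigma> - n * n) \<in> worono"
    by (simp add: algebra_simps nm)
  have basis: "b * gen l \<in> WS.span" if "b \<in> {1, \<rho>, \<rho>', \<sigma>}" for b l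
  proof (cases l)
    case Sig
    note \<sigma> = this
    have "\<sigma> * \<sigma> \<in> WS.span"
      by (rule WS.spanI[of _ "- (inverse (mu \<kappa>) * inverse (mu \<kappa>))" 0 0 "inverse (mu \<kappa>) * inverse (mu \<kappa>) + 1"])
        (use \<sigma>\<sigma> in \<open>simp_all add: scal_simps n_def[symmetric] algebra_simps\<close>)
    moreover have "\<rho> * \<sigma> \<in> WS.span"
      by (rule WS.spanI[of _ 0 "inverse (mu \<kappa>)" 0 0]) (use \<rho>\<sigma> in \<open>simp_all add: n_def\<close>)
    moreover have "\<rho>' * \<sigma> \<in> WS.span"
      by (rule WS.spanI[of _ 0 0 "inverse (mu \<kappa>)" 0]) (use \<rho>\<sigma> in \<open>simp_all add: n_def\<close>)
    ultimately show ?thesis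
      using that WS.span_basis \<sigma> by auto
  next
    case Sig_star
    note \<sigma>' = this
    have "\<sigma>' \<in> WS.span"
      by (rule WS.spanI[of _ "1 + mu \<kappa> * mu \<kappa>" 0 0 "- (mu \<kappa> * mu \<kappa>)"])
        (use W(6) in \<open>simp_all add: scal_simps m_def[symmetric] algebra_simps\<close>)
    moreover have "\<sigma> * \<sigma>' \<in> WS.span"
      by (rule WS.spanI[of _ 1 0 0 0]) (use \<sigma>\<sigma>' in \<open>simp_all add: scal_simps(2)\<close>)
    moreover have "\<rho> * \<sigma>' \<in> WS.span"
      by (rule WS.spanI[of _ 0 "mu \<kappa>" 0 0]) (use \<rho>\<sigma>' in \<open>simp_all add: m_def\<close>)
    moreover have "\<rho>' * \<sigma>' \<in> WS.span"
      by (rule WS.spanI[of _ 0 0 "mu \<kappa>" 0]) (use \<rho>\<sigma>' in \<open>simp_all add: m_def\<close>)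
    ultimately show ?thesis
      using that \<sigma>' by auto
  next
    case Rho
    note \<rho> = this
    have "\<sigma> * \<rho> \<in> WS.span"
      by (rule WS.spanI[of _ 0 1 0 0]) (use \<sigma>\<rho> in \<open>simp_all add: scal_simps(2)\<close>)
    then show ?thesis
      using that \<rho> WS.span_basis WS.span_P W by auto
  next
    case Rho_star
    note \<rho>' = this
    have "\<sigma> * \<rho>' \<in> WS.span"
      by (rule WS.spanI[of _ 0 0 1 0]) (use \<sigma>\<rho> in \<open>simp_all add: scal_simps(2)\<close>)
    then show ?thesis
      using that \<rho>' WS.span_basis WS.span_P W \<rho>\<rho>' by auto
  qed
  have word: "Poly_Mapping.single (Word xs) 1 \<in> WS.span" for xs
  proof (induction xs rule: rev_induct)
    case Nil
    then show ?case
      using WS.span_basis(1) by (simp add: zero_word_def[symmetric] single_one)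
  next
    case (snoc x xs)
    have "Poly_Mapping.single (Word (xs @ [x])) 1 = Poly_Mapping.single (Word xs) 1 * gen x"
      by (simp add: gen_def mult_single plus_word_def)
    with snoc show ?case
      using WS.span_mult_right[OF snoc worono_mult] basis[of 1] basis[of \<rho>] basis[of \<rho>'] basis[of \<sigma>]
      by auto
  qed
  show ?thesis
  proof (induction p rule: free_alg_induct)
    case 1
    then show ?case by (simp add: WS.span_P worono_zero)
  next
    case (2 u c q)
    have "Poly_Mapping.single u c = scal c * Poly_Mapping.single (Word (letters u)) 1"
      by (simp add: mult_single)
    then show ?case
      using WS.span_add[OF WS.span_scal[OF word] 2, of c "letters u"] by simp
  qed
qed

lemma worono_iff:
  "p \<in> worono \<longleftrightarrow> character 1 p = 0 \<and> coord_rho p = 0 \<and> coord_T p = 0 \<and> coord_U p = 0"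
proof
  assume *: "character 1 p = 0 \<and> coord_rho p = 0 \<and> coord_T p = 0 \<and> coord_U p = 0"
  obtain c0 c1 c2 c3 where p: "p - (scal c0 + scal c1 * \<rho> + scal c2 * \<rho>' + scal c3 * \<sigma>) \<in> worono"
    using worono_span[of p] by (auto elim: WS.spanE)
  from worono_coords_zero[OF this] * have "c3 = 0" "c2 = 0" "c1 = 0" "c0 = 0"
    by (auto simp: coord_defs)
  with p show "p \<in> worono"
    by simp
qed (rule worono_coords_zero)



section \<open>The \<open>\<complex>[[h]]\<close>-subalgebra\<close>

text \<open>
  \<open>\<delta> = (\<mu> - 1) / (2 h)\<close> is a power series with constant term \<open>1 / (2 \<kappa>)\<close>.  Every occurrence of
  \<open>1 / (2 \<kappa>)\<close> in the limit comes from it.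
\<close>

definition delta :: "complex fls" where "delta = fls_X_inv * (1/2) * (mu \<kappa> - 1)"

lemma mu_PS: "mu \<kappa> \<in> PS" "fls_nth (mu \<kappa>) 0 = 1"
  "inverse (mu \<kappa>) \<in> PS" "fls_nth (inverse (mu \<kappa>)) 0 = 1"
proof -
  show *: "mu \<kappa> \<in> PS" "fls_nth (mu \<kappa>) 0 = 1"
    by (simp_all add: mu_def PS_def)
  show "inverse (mu \<kappa>) \<in> PS" "fls_nth (inverse (mu \<kappa>)) 0 = 1"
    using PS_inverse[OF *(1)] *(2) by simp_all
qed

lemma delta_PS: "delta \<in> PS" "fls_nth delta 0 = complex_of_real (1 / (2 * \<kappa>))"
proof -
  obtain d where d: "d \<in> PS" "mu \<kappa> - 1 = fls_X * d" "fls_nth d 0 = fls_nth (mu \<kappa> - 1) 1"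
    by (rule PS_divide_X[of "mu \<kappa> - 1"]) (simp_all add: PS_closed mu_PS)
  have d0: "fls_nth d 0 = complex_of_real (1 / \<kappa>)"
    using d(3) by (simp add: mu_def)
  have "delta = 1/2 * d * (fls_X_inv * fls_X)"
    unfolding delta_def d(2) by (simp only: mult_ac)
  then have delta: "delta = 1/2 * d"
    by (simp only: X_inv_X mult_1_right)
  show "delta \<in> PS" "fls_nth delta 0 = complex_of_real (1 / (2 * \<kappa>))"
    unfolding delta using d(1) d0 PS_half
    by (simp_all only: PS_closed PS_nth_mult) simp
qed

text \<open>Representatives in the free algebra of \<open>a\<close>, \<open>a\<^sup>*\<close>, \<open>w\<close>, \<open>w\<^sup>*\<close>.\<close>

definition lift_a :: free_alg where
  "lift_a = scal (1/2) * (\<sigma> + \<rho> - scal (mu \<kappa>) * \<rho>' + \<sigma>')"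

definition lift_a' :: free_alg where
  "lift_a' = scal (1/2) * (\<sigma>' + \<rho>' - scal (mu \<kappa>) * \<rho> + \<sigma>)"

definition lift_w :: free_alg where
  "lift_w = scal (fls_X_inv * (1/2)) * (- \<sigma> - \<rho> - scal (mu \<kappa>) * \<rho>' + \<sigma>')"

definition lift_w' :: free_alg where
  "lift_w' = scal (fls_X_inv * (1/2)) * (- \<sigma>' - \<rho>' - scal (mu \<kappa>) * \<rho> + \<sigma>)"

lemmas lift_defs = lift_a_def lift_a'_def lift_w_def lift_w'_def

lemma class_lifts:
  "su_a \<kappa> = su_class \<kappa> lift_a" "su_star (su_class \<kappa> lift_a) = su_class \<kappa> lift_a'"
  "su_w \<kappa> = su_class \<kappa> lift_w" "su_star (su_class \<kappa> lift_w) = su_class \<kappa> lift_w'"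
  using su_star_a[of \<kappa>] su_star_w[of \<kappa>] by (simp_all only: su_a_def su_w_def lift_defs)

text \<open>The representatives of the elements of the \<open>\<complex>[[h]]\<close>-subalgebra \<open>L\<close>.\<close>

definition lat :: "free_alg set" where "lat = {p. su_class \<kappa> p \<in> lattice_alg \<kappa>}"

lemma lat_closed:
  shows lat_lifts: "lift_a \<in> lat" "lift_a' \<in> lat" "lift_w \<in> lat" "lift_w' \<in> lat"
    and lat_scal: "c \<in> PS \<Longrightarrow> scal c \<in> lat"
    and lat_one: "1 \<in> lat"
    and lat_uminus: "p \<in> lat \<Longrightarrow> - p \<in> lat"
    and lat_add: "p \<in> lat \<Longrightarrow> q \<in> lat \<Longrightarrow> p + q \<in> lat"
    and lat_mult: "p \<in> lat \<Longrightarrow> q \<in> lat \<Longrightarrow> p * q \<in> lat"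
    and lat_diff: "p \<in> lat \<Longrightarrow> q \<in> lat \<Longrightarrow> p - q \<in> lat"
proof -
  show "lift_a \<in> lat" "lift_a' \<in> lat" "lift_w \<in> lat" "lift_w' \<in> lat"
    by (simp_all add: lat_def lattice_alg_def class_lifts generate_ring.incl)
  show "c \<in> PS \<Longrightarrow> scal c \<in> lat"
    by (auto simp: lat_def lattice_alg_def PS_def intro!: generate_ring.incl)
  show "1 \<in> lat"
    by (simp add: lat_def lattice_alg_def su_class_one generate_ring.one)
  show uminus: "p \<in> lat \<Longrightarrow> - p \<in> lat" for p
    using SU.hom_uminus by (simp add: lat_def lattice_alg_def generate_ring.a_inv)
  show add: "p \<in> lat \<Longrightarrow> q \<in> lat \<Longrightarrow> p + q \<in> lat" for p q
    by (simp add: lat_def lattice_alg_def su_class_add generate_ring.eng_add)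
  show "p \<in> lat \<Longrightarrow> q \<in> lat \<Longrightarrow> p * q \<in> lat"
    by (simp add: lat_def lattice_alg_def su_class_mult generate_ring.eng_mult)
  show "p \<in> lat \<Longrightarrow> q \<in> lat \<Longrightarrow> p - q \<in> lat"
    using add[of p "- q"] uminus[of q] by simp
qed

lemma lat_kernel: "p \<in> su_kernel \<kappa> \<Longrightarrow> p \<in> lat"
  using su_class_eq_iff[of p 0] lat_diff[OF lat_one lat_one] by (simp add: lat_def)

lemma lat_induct [consumes 1, case_names kernel a a' w w' scal uminus add mult]:
  assumes "p \<in> lat"
    and kernel: "\<And>k. k \<in> su_kernel \<kappa> \<Longrightarrow> P k"
    and lifts: "P lift_a" "P lift_a'" "P lift_w" "P lift_w'"
    and scal: "\<And>c. c \<in> PS \<Longrightarrow> P (scal c)"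
    and uminus: "\<And>q. q \<in> lat \<Longrightarrow> P q \<Longrightarrow> P (- q)"
    and add: "\<And>q r. q \<in> lat \<Longrightarrow> r \<in> lat \<Longrightarrow> P q \<Longrightarrow> P r \<Longrightarrow> P (q + r)"
    and mult: "\<And>q r. q \<in> lat \<Longrightarrow> r \<in> lat \<Longrightarrow> P q \<Longrightarrow> P r \<Longrightarrow> P (q * r)"
  shows "P p"
proof -
  have "\<exists>q\<in>lat. x = su_class \<kappa> q \<and> P q" if "x \<in> lattice_alg \<kappa>" for x
    using that unfolding lattice_alg_def
  proof (induction rule: generate_ring.induct)
    case one
    then show ?case
      using scal[of 1] lat_one by (auto simp: scal_simps(2) PS_closed su_class_one[symmetric])
  next
    case (incl x)
    then show ?case
      using lifts lat_lifts scal lat_scal by (auto simp: class_lifts PS_def)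
  next
    case (a_inv x)
    then show ?case
      using uminus lat_uminus SU.hom_uminus by (metis UNIV_I)
  next
    case (eng_add x y)
    then show ?case
      using add lat_add su_class_add by metis
  next
    case (eng_mult x y)
    then show ?case
      using mult lat_mult su_class_mult by metis
  qed
  then obtain q where q: "q \<in> lat" "su_class \<kappa> p = su_class \<kappa> q" "P q"
    using assms(1) by (auto simp: lat_def)
  then have "p - q \<in> su_kernel \<kappa>"
    by (simp add: su_class_eq_iff)
  then show ?thesis
    using add[OF q(1) lat_kernel q(3) kernel] by fastforce
qed

lemma lift_functionals:
  "character s lift_a = 1/2 * (s + inverse s)" "character s lift_a' = 1/2 * (s + inverse s)"
  "character s lift_w = fls_X_inv * (1/2) * (s - inverse s)"
  "character s lift_w' = fls_X_inv * (1/2) * (inverse s - s)"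
  "coord_rho lift_a = 1/2 * (1 + mu \<kappa>)" "coord_rho lift_a' = - (1/2 * (1 + mu \<kappa>))"
  "coord_rho lift_w = delta" "coord_rho lift_w' = - delta"
  "coord_T lift_a = - (1/2 * mu \<kappa> * fls_X)" "coord_T lift_a' = 1/2 * fls_X"
  "coord_T lift_w = - (1/2 * mu \<kappa>)" "coord_T lift_w' = - (1/2)"
  "coord_U lift_a = 1/2 * fls_X * (1 - mu \<kappa> * mu \<kappa>)"
  "coord_U lift_a' = 1/2 * fls_X * (1 - mu \<kappa> * mu \<kappa>)"
  "coord_U lift_w = - (1/2 * (1 + mu \<kappa> * mu \<kappa>))"
  "coord_U lift_w' = 1/2 * (1 + mu \<kappa> * mu \<kappa>)"
  using X_inv_X
  by (simp_all add: coord_defs lift_defs delta_def field_simps)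


text \<open>
  The factor \<open>1 / h\<close> in \<open>w\<close> and \<open>w\<^sup>*\<close> is absorbed by \<open>\<delta>\<close>, because \<open>\<mu> - \<mu>\<^sup>-\<^sup>1\<close> and \<open>\<mu>\<^sup>2 - \<mu>\<^sup>-\<^sup>2\<close> are
  multiples of \<open>\<mu> - 1\<close>.
\<close>

lemma lift_characters:
  "character 1 lift_w = 0" "character 1 lift_w' = 0"
  "character (mu \<kappa>) lift_w = delta * inverse (mu \<kappa>) * (1 + mu \<kappa>)"
  "character (mu \<kappa>) lift_w' = - (delta * inverse (mu \<kappa>) * (1 + mu \<kappa>))"
  "character (mu \<kappa> * mu \<kappa>) lift_w =
    delta * (1 + mu \<kappa>) * (1 + inverse (mu \<kappa>) * inverse (mu \<kappa>))"
  "character (mu \<kappa> * mu \<kappa>) lift_w' =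
    - (delta * (1 + mu \<kappa>) * (1 + inverse (mu \<kappa>) * inverse (mu \<kappa>)))"
  by (simp_all add: lift_functionals delta_def field_simps)

lemma lat_functionals:
  assumes "p \<in> lat"
  shows "character 1 p \<in> PS \<and> character (mu \<kappa>) p \<in> PS \<and> character (mu \<kappa> * mu \<kappa>) p \<in> PS \<and>
    coord_rho p \<in> PS \<and> coord_T p \<in> PS \<and> coord_U p \<in> PS"
  using assms
proof (induction rule: lat_induct)
  case (kernel k)
  then show ?case by (simp add: kernel_coords_zero PS_closed)
qed (simp_all only: lift_functionals(1,2,5-) lift_characters PS_closed PS_half mu_PS delta_PS
    inverse_mult_distrib inverse_1 simp_thms, simp_all add: coord_defs PS_closed)


section \<open>Constant terms of the functionals\<close>

text \<open>The constant term of a functional, as a complex-valued functional.\<close>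

definition ct :: "(free_alg \<Rightarrow> complex fls) \<Rightarrow> free_alg \<Rightarrow> complex"
  where "ct F p = fls_nth (F p) 0"

lemma ct_linear [simp]:
  "ct (character s) (p + q) = ct (character s) p + ct (character s) q"
  "ct (character s) (p - q) = ct (character s) p - ct (character s) q"
  "ct (character s) (- p) = - ct (character s) p"
  "ct coord_rho (p + q) = ct coord_rho p + ct coord_rho q"
  "ct coord_rho (p - q) = ct coord_rho p - ct coord_rho q"
  "ct coord_rho (- p) = - ct coord_rho p"
  "ct coord_T (p + q) = ct coord_T p + ct coord_T q"
  "ct coord_T (p - q) = ct coord_T p - ct coord_T q"
  "ct coord_T (- p) = - ct coord_T p"
  "ct coord_U (p + q) = ct coord_U p + ct coord_U q"
  "ct coord_U (p - q) = ct coord_U p - ct coord_U q"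
  "ct coord_U (- p) = - ct coord_U p"
  by (simp_all add: ct_def coord_defs)

lemma ct_scal [simp]:
  "ct (character s) (scal (fls_const z)) = z" "ct (character s) 1 = 1" "ct (character s) 0 = 0"
  "ct coord_rho (scal c) = 0" "ct coord_rho 1 = 0" "ct coord_rho 0 = 0"
  "ct coord_T (scal c) = 0" "ct coord_T 1 = 0" "ct coord_T 0 = 0"
  "ct coord_U (scal c) = 0" "ct coord_U 1 = 0" "ct coord_U 0 = 0"
  by (simp_all add: ct_def coord_defs)

lemma ct_mult:
  assumes "p \<in> lat" "q \<in> lat"
  shows "ct (character 1) (p * q) = ct (character 1) p * ct (character 1) q"
    "ct (character (mu \<kappa>)) (p * q) = ct (character (mu \<kappa>)) p * ct (character (mu \<kappa>)) q"
    "ct (character (mu \<kappa> * mu \<kappa>)) (p * q) =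
      ct (character (mu \<kappa> * mu \<kappa>)) p * ct (character (mu \<kappa> * mu \<kappa>)) q"
    "ct coord_rho (p * q) =
      ct (character 1) p * ct coord_rho q + ct coord_rho p * ct (character (mu \<kappa>)) q"
    "ct coord_T (p * q) =
      ct (character 1) p * ct coord_T q + ct coord_T p * ct (character (mu \<kappa>)) q"
    "ct coord_U (p * q) =
      ct (character 1) p * ct coord_U q + ct coord_U p * ct (character (mu \<kappa> * mu \<kappa>)) q"
  using lat_functionals[OF assms(1)] lat_functionals[OF assms(2)]
  by (auto simp: ct_def coord_defs PS_nth_mult)

lemma ct_lifts:
  defines "t \<equiv> complex_of_real (1 / (2 * \<kappa>))"
  shows "ct (character 1) lift_a = 1" "ct (character 1) lift_a' = 1"
    "ct (character 1) lift_w = 0" "ct (character 1) lift_w' = 0"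
    "ct (character (mu \<kappa>)) lift_a = 1" "ct (character (mu \<kappa>)) lift_a' = 1"
    "ct (character (mu \<kappa>)) lift_w = 2 * t" "ct (character (mu \<kappa>)) lift_w' = - (2 * t)"
    "ct (character (mu \<kappa> * mu \<kappa>)) lift_a = 1" "ct (character (mu \<kappa> * mu \<kappa>)) lift_a' = 1"
    "ct (character (mu \<kappa> * mu \<kappa>)) lift_w = 4 * t" "ct (character (mu \<kappa> * mu \<kappa>)) lift_w' = - (4 * t)"
    "ct coord_rho lift_a = 1" "ct coord_rho lift_a' = - 1"
    "ct coord_rho lift_w = t" "ct coord_rho lift_w' = - t"
    "ct coord_T lift_a = 0" "ct coord_T lift_a' = 0"
    "ct coord_T lift_w = - 1/2" "ct coord_T lift_w' = - 1/2"
    "ct coord_U lift_a = 0" "ct coord_U lift_a' = 0"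
    "ct coord_U lift_w = - 1" "ct coord_U lift_w' = 1"
  unfolding ct_def lift_functionals(1,2,5-) lift_characters inverse_mult_distrib inverse_1 t_def
  by (simp_all add: PS_nth_mult PS_closed PS_half mu_PS delta_PS
      del: mult_minus_left mult_minus_right times_divide_eq_left times_divide_eq_right
        of_real_divide)
    simp_all



section \<open>The limit ring\<close>

text \<open>The representatives of the elements of \<open>h L\<close>.\<close>

definition hlat :: "free_alg set" where "hlat = {p. su_class \<kappa> p \<in> h_lattice \<kappa>}"

lemma hlat_iff: "p \<in> hlat \<longleftrightarrow> (\<exists>q\<in>lat. p - scal fls_X * q \<in> su_kernel \<kappa>)"
proof
  assume "p \<in> hlat"
  then obtain x where x: "x \<in> lattice_alg \<kappa>" "su_class \<kappa> p = su_class \<kappa> (scal fls_X) \<otimes>\<^bsub>SU \<kappa>\<^esub> x"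
    by (auto simp: hlat_def h_lattice_def)
  then obtain q where "x = su_class \<kappa> q"
    using lattice_alg_carrier carrier_SU by blast
  with x show "\<exists>q\<in>lat. p - scal fls_X * q \<in> su_kernel \<kappa>"
    by (auto simp: lat_def su_class_mult[symmetric] su_class_eq_iff)
next
  assume "\<exists>q\<in>lat. p - scal fls_X * q \<in> su_kernel \<kappa>"
  then show "p \<in> hlat"
    by (auto simp: hlat_def h_lattice_def lat_def su_class_mult su_class_eq_iff[symmetric])
qed

lemma hlat_closed:
  shows hlat_kernel: "p \<in> su_kernel \<kappa> \<Longrightarrow> p \<in> hlat"
    and hlat_X: "q \<in> lat \<Longrightarrow> scal fls_X * q \<in> hlat"
    and hlat_lat: "p \<in> hlat \<Longrightarrow> p \<in> lat"
    and hlat_add: "p \<in> hlat \<Longrightarrow> p' \<in> hlat \<Longrightarrow> p + p' \<in> hlat"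
    and hlat_diff: "p \<in> hlat \<Longrightarrow> p' \<in> hlat \<Longrightarrow> p - p' \<in> hlat"
    and hlat_mult_right: "p \<in> hlat \<Longrightarrow> q \<in> lat \<Longrightarrow> p * q \<in> hlat"
    and hlat_mult_left: "p \<in> hlat \<Longrightarrow> q \<in> lat \<Longrightarrow> q * p \<in> hlat"
proof -
  have zero: "0 \<in> lat"
    using lat_diff[OF lat_one lat_one] by simp
  show "p \<in> su_kernel \<kappa> \<Longrightarrow> p \<in> hlat"
    unfolding hlat_iff by (rule bexI[OF _ zero]) simp
  show "q \<in> lat \<Longrightarrow> scal fls_X * q \<in> hlat"
    unfolding hlat_iff by (rule bexI[of _ q]) (simp_all add: kernel_zero)
  show "p \<in> lat" if "p \<in> hlat"
  proof -
    obtain q where "q \<in> lat" "p - scal fls_X * q \<in> su_kernel \<kappa>"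
      using \<open>p \<in> hlat\<close> by (auto simp: hlat_iff)
    then show ?thesis
      using lat_add[OF lat_kernel lat_mult[OF lat_scal[OF PS_closed(5)]]] by fastforce
  qed
  show "p + p' \<in> hlat" "p - p' \<in> hlat" if "p \<in> hlat" "p' \<in> hlat"
  proof -
    obtain q q' where q: "q \<in> lat" "p - scal fls_X * q \<in> su_kernel \<kappa>"
        "q' \<in> lat" "p' - scal fls_X * q' \<in> su_kernel \<kappa>"
      using \<open>p \<in> hlat\<close> \<open>p' \<in> hlat\<close> by (auto simp: hlat_iff)
    show "p + p' \<in> hlat"
      unfolding hlat_iff using kernel_add[OF q(2,4)]
      by (intro bexI[OF _ lat_add[OF q(1,3)]]) (simp add: algebra_simps)
    show "p - p' \<in> hlat"
      unfolding hlat_iff using kernel_diff[OF q(2,4)]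
      by (intro bexI[OF _ lat_diff[OF q(1,3)]]) (simp add: algebra_simps)
  qed
  show "p * q \<in> hlat" "q * p \<in> hlat" if "p \<in> hlat" "q \<in> lat"
  proof -
    obtain r where r: "r \<in> lat" "p - scal fls_X * r \<in> su_kernel \<kappa>"
      using \<open>p \<in> hlat\<close> by (auto simp: hlat_iff)
    show "p * q \<in> hlat"
      unfolding hlat_iff using kernel_mult_right[OF r(2), of q]
      by (intro bexI[OF _ lat_mult[OF r(1) \<open>q \<in> lat\<close>]]) (simp add: algebra_simps)
    have "q * (scal fls_X * r) = scal fls_X * (q * r)"
      by (metis mult.assoc scal_commute)
    then show "q * p \<in> hlat"
      unfolding hlat_iff using kernel_mult_left[OF r(2), of q]
      by (intro bexI[OF _ lat_mult[OF \<open>q \<in> lat\<close> r(1)]]) (simp add: algebra_simps)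
  qed
qed

lemma hlat_small_scal:
  assumes "c \<in> PS" "fls_nth c 0 = 0" "p \<in> lat"
  shows "scal c * p \<in> hlat"
proof -
  obtain d where d: "d \<in> PS" "c = fls_X * d"
    using assms(1,2) by (rule PS_divide_X)
  then show ?thesis
    using hlat_X[OF lat_mult[OF lat_scal[OF d(1)] assms(3)]] by (simp add: scal_simps mult.assoc)
qed

text \<open>The map sending a representative of an element of \<open>L\<close> to its limit in \<open>E = L / h L\<close>.\<close>

definition lim_map :: "free_alg \<Rightarrow> free_alg set set"
  where "lim_map p = limit_class \<kappa> (su_class \<kappa> p)"

interpretation E: ring_presentation lat lim_map "E_tilde \<kappa>"
proof (rule ring_presentation.intro)
  have hom: "limit_class \<kappa> \<in> ring_hom (lattice_ring \<kappa>) (E_tilde \<kappa>)"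
    using ideal.rcos_ring_hom[OF ideal_h_lattice[of \<kappa>]]
    by (simp add: E_tilde_def limit_class_def[abs_def])
  have lat: "su_class \<kappa> p \<in> carrier (lattice_ring \<kappa>)" if "p \<in> lat" for p
    using that by (simp add: lat_def lattice_ring_def)
  show "lim_map 1 = \<one>\<^bsub>E_tilde \<kappa>\<^esub>"
    using ring_hom_one[OF hom] by (simp add: lim_map_def su_class_one lattice_ring_def)
  show "lim_map (p + q) = lim_map p \<oplus>\<^bsub>E_tilde \<kappa>\<^esub> lim_map q" if "p \<in> lat" "q \<in> lat" for p q
    using ring_hom_add[OF hom lat[OF that(1)] lat[OF that(2)]]
    by (simp add: lim_map_def su_class_add lattice_ring_def)
  show "lim_map (p * q) = lim_map p \<otimes>\<^bsub>E_tilde \<kappa>\<^esub> lim_map q" if "p \<in> lat" "q \<in> lat" for p q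
    using ring_hom_mult[OF hom lat[OF that(1)] lat[OF that(2)]]
    by (simp add: lim_map_def su_class_mult lattice_ring_def)
  have "carrier (E_tilde \<kappa>) = limit_class \<kappa> ` lattice_alg \<kappa>"
    by (auto simp: E_tilde_def FactRing_def A_RCOSETS_def RCOSETS_def limit_class_def
        a_r_coset_def lattice_ring_def)
  also have "lattice_alg \<kappa> = su_class \<kappa> ` lat"
    using lattice_alg_carrier[of \<kappa>] by (auto simp: lat_def carrier_SU)
  finally show "lim_map ` lat = carrier (E_tilde \<kappa>)"
    by (simp add: lim_map_def image_image)
qed (simp_all add: ring_E_tilde lat_closed)

lemma lim_map_eq_iff:
  assumes "p \<in> lat" "q \<in> lat"
  shows "lim_map p = lim_map q \<longleftrightarrow> p - q \<in> hlat"
proof -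
  interpret H: ideal "h_lattice \<kappa>" "lattice_ring \<kappa>" by (rule ideal_h_lattice)
  have zero: "lim_map r = \<zero>\<^bsub>E_tilde \<kappa>\<^esub> \<longleftrightarrow> r \<in> hlat" if "r \<in> lat" for r
  proof -
    have "\<zero>\<^bsub>E_tilde \<kappa>\<^esub> = h_lattice \<kappa>"
      by (simp add: E_tilde_def FactRing_def)
    moreover have "su_class \<kappa> r \<in> carrier (lattice_ring \<kappa>)"
      using that by (simp add: lat_def lattice_ring_def)
    ultimately show ?thesis
      using H.a_rcos_self[of "su_class \<kappa> r"] H.a_rcos_const[of "su_class \<kappa> r"]
      by (auto simp: lim_map_def limit_class_def hlat_def)
  qed
  have "lim_map p = lim_map q \<longleftrightarrow> lim_map p \<ominus>\<^bsub>E_tilde \<kappa>\<^esub> lim_map q = \<zero>\<^bsub>E_tilde \<kappa>\<^esub>"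
    using assms by (simp add: E.hom_carrier E.r_right_minus_eq)
  then show ?thesis
    using assms by (simp add: zero lat_diff flip: E.hom_diff)
qed

lemma hlat_ct_zero:
  assumes "p \<in> hlat"
  shows "ct (character 1) p = 0 \<and> ct coord_rho p = 0 \<and> ct coord_T p = 0 \<and> ct coord_U p = 0"
proof -
  obtain q where q: "q \<in> lat" "p - scal fls_X * q \<in> su_kernel \<kappa>"
    using assms by (auto simp: hlat_iff)
  have "character 1 p = fls_X * character 1 q" "coord_rho p = fls_X * coord_rho q"
      "coord_T p = fls_X * coord_T q" "coord_U p = fls_X * coord_U q"
    using kernel_coords_zero[OF q(2)] by (simp_all add: coord_defs)
  then show ?thesis
    using lat_functionals[OF q(1)] by (simp add: ct_def PS_nth_mult PS_closed)
qed


section \<open>Elements with vanishing limit coordinates\<close>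

text \<open>Linear identities between the four generators, checked coefficientwise.\<close>

lemmas free_linear = gen_def mult_single distrib_left right_diff_distrib mult.assoc[symmetric]
  lookup_add lookup_minus lookup_single when_def

text \<open>
  \<open>T\<close>, \<open>\<rho> - \<rho>\<^sup>*\<close>, \<open>U\<close> and \<open>\<sigma> + \<sigma>\<^sup>*\<close> are \<open>\<complex>[[h]]\<close>-linear combinations of \<open>a, a\<^sup>*, w, w\<^sup>*\<close>, because
  \<open>1 + \<mu>\<close> is invertible in \<open>\<complex>[[h]]\<close>.
\<close>

lemma lat_generators:
  shows lat_T: "scal fls_X_inv * (\<rho> + \<rho>') \<in> lat" and lat_U: "scal fls_X_inv * (\<sigma> - \<sigma>') \<in> lat"
    and lat_gen: "gen l \<in> lat"
proof -
  define T where "T = scal fls_X_inv * (\<rho> + \<rho>')"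
  define U where "U = scal fls_X_inv * (\<sigma> - \<sigma>')"
  define D where "D = \<rho> - \<rho>'"
  have inv: "inverse (1 + mu \<kappa>) \<in> PS"
    by (rule PS_inverse) (simp_all add: PS_closed mu_PS)
  have "fls_nth (1 + mu \<kappa>) 0 \<noteq> 0"
    by (simp add: mu_PS)
  then have "1 + mu \<kappa> \<noteq> 0"
    by (rule fls_nonzeroI)
  then have unit: "p \<in> lat" if "scal (1 + mu \<kappa>) * p \<in> lat" for p
    using lat_mult[OF lat_scal[OF inv] that] by (simp add: mult.assoc[symmetric] mult_single)
  note lat = lat_closed PS_closed PS_half mu_PS delta_PS
  have "scal (1 + mu \<kappa>) * T = - (lift_w + lift_w' + (lift_w + lift_w'))"
    by (intro poly_mapping_eqI) (simp add: T_def lift_defs free_linear, simp add: field_simps)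
  also have "\<dots> \<in> lat"
    by (intro lat)
  finally have T: "T \<in> lat"
    by (rule unit)
  have "scal (1 + mu \<kappa>) * D = (lift_a - lift_a') + (lift_a - lift_a')"
    by (intro poly_mapping_eqI) (simp add: D_def lift_defs free_linear field_simps)
  also have "\<dots> \<in> lat"
    by (intro lat)
  finally have D: "D \<in> lat"
    by (rule unit)
  have "U = scal delta * D - (lift_w - lift_w')"
    by (intro poly_mapping_eqI)
      (simp add: D_def U_def lift_defs free_linear, simp add: delta_def field_simps)
  also have "\<dots> \<in> lat"
    by (intro lat D)
  finally have U: "U \<in> lat" .
  have XT: "\<rho> + \<rho>' = scal fls_X * T" and XU: "\<sigma> - \<sigma>' = scal fls_X * U"
    by (simp_all add: T_def U_def mult.assoc[symmetric] mult_single X_inv_X)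
  have "\<sigma> + \<sigma>' = lift_a + lift_a' + scal (1/2 * (mu \<kappa> - 1)) * (\<rho> + \<rho>')"
    by (intro poly_mapping_eqI) (simp add: lift_defs free_linear)
  also have "\<dots> \<in> lat"
    unfolding XT by (intro lat T)
  finally have S: "\<sigma> + \<sigma>' \<in> lat" .
  have half: "p \<in> lat \<and> q \<in> lat" if "p + q \<in> lat" "p - q \<in> lat" for p q
  proof -
    have "p = scal (1/2) * ((p + q) + (p - q))" "q = scal (1/2) * ((p + q) - (p - q))"
      by (simp_all add: distrib_left distrib_right[symmetric] scal_simps(2) flip: single_add)
    then show ?thesis
      using lat_mult lat_scal PS_half lat_add lat_diff that by metis
  qed
  have "\<rho> \<in> lat \<and> \<rho>' \<in> lat" "\<sigma> \<in> lat \<and> \<sigma>' \<in> lat"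
    by (rule half; (fold D_def)?; (simp only: XT XU S)?; intro lat T U D S)+
  then show "gen l \<in> lat"
    by (cases l) auto
  show "scal fls_X_inv * (\<rho> + \<rho>') \<in> lat" "scal fls_X_inv * (\<sigma> - \<sigma>') \<in> lat"
    using T U by (simp_all add: T_def U_def)
qed

text \<open>In the limit \<open>\<rho>\<^sup>* = -\<rho>\<close> and \<open>\<sigma>\<^sup>* = \<sigma>\<close>.\<close>

lemma hlat_adjoints: "\<rho> + \<rho>' \<in> hlat" "\<sigma> - \<sigma>' \<in> hlat"
  using hlat_X[OF lat_T] hlat_X[OF lat_U]
  by (simp_all add: mult.assoc[symmetric] mult_single X_inv_X scal_simps(2))

lemma contractionI:
  assumes "p \<in> lat"
    and "ct (character 1) p = 0" "ct coord_rho p = 0" "ct coord_T p = 0" "ct coord_U p = 0"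
  shows "lim_map p \<in> contraction \<kappa> (woronowicz_ideal \<kappa>)"
proof -
  note PS = lat_functionals[OF assms(1)]
  obtain c0 where c0: "c0 \<in> PS" "character 1 p = fls_X * c0"
    by (rule PS_divide_X[of "character 1 p"]) (use PS assms(2) in \<open>simp_all add: ct_def\<close>)
  obtain c1 where c1: "c1 \<in> PS" "coord_rho p = fls_X * c1"
    by (rule PS_divide_X[of "coord_rho p"]) (use PS assms(3) in \<open>simp_all add: ct_def\<close>)
  obtain c2 where c2: "c2 \<in> PS" "coord_T p = fls_X * c2"
    by (rule PS_divide_X[of "coord_T p"]) (use PS assms(4) in \<open>simp_all add: ct_def\<close>)
  obtain c3 where c3: "c3 \<in> PS" "coord_U p = fls_X * c3"
    by (rule PS_divide_X[of "coord_U p"]) (use PS assms(5) in \<open>simp_all add: ct_def\<close>)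
  define n where "n = inverse (1 + mu \<kappa> * mu \<kappa>)"
  have nth: "fls_nth (1 + mu \<kappa> * mu \<kappa>) 0 \<noteq> 0"
    by (simp add: mu_PS PS_nth_mult)
  then have n: "n \<in> PS"
    unfolding n_def by (intro PS_inverse PS_closed mu_PS)
  have "1 + mu \<kappa> * mu \<kappa> \<noteq> 0"
    using nth by (rule fls_nonzeroI)
  then have n1: "n + n * (mu \<kappa> * mu \<kappa>) = 1"
    by (simp add: n_def field_simps)
  \<comment> \<open>\<open>y\<close> has the coordinates \<open>c0, c1, c2, c3\<close>; the factor \<open>n\<close> is needed since the coordinate
    \<^const>\<open>coord_U\<close> of \<open>U\<close> is \<open>1 + \<mu>\<^sup>2\<close>.\<close>
  define y where "y = scal c0 + scal c1 * \<rho> + scal c2 * (scal fls_X_inv * (\<rho> + \<rho>')) +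
    scal (c3 * n) * (scal fls_X_inv * (\<sigma> - \<sigma>'))"
  have y: "y \<in> lat"
    unfolding y_def by (intro lat_add lat_mult lat_scal lat_T lat_U lat_gen c0(1) c1(1) c2(1) PS_closed c3(1) n)
  have "character 1 y = c0" "coord_rho y = c1"
    by (simp_all add: y_def coord_defs)
  moreover have "coord_T y = c2 * (fls_X_inv * fls_X)"
    by (simp add: y_def coord_defs)
  moreover have "coord_U y = c3 * (fls_X_inv * fls_X) * (n + n * (mu \<kappa> * mu \<kappa>))"
    by (simp add: y_def coord_defs algebra_simps)
  ultimately have "p - scal fls_X * y \<in> worono"
    using c0(2) c1(2) c2(2) c3(2) by (simp add: worono_iff X_inv_X n1) (simp add: coord_defs)
  moreover have *: "p - scal fls_X * y \<in> lat"
    by (intro lat_diff lat_mult lat_scal assms(1) y PS_closed)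
  ultimately have "lim_map (p - scal fls_X * y) \<in> contraction \<kappa> (woronowicz_ideal \<kappa>)"
    by (auto simp: contraction_def lim_map_def worono_def lat_def)
  moreover have "lim_map p = lim_map (p - scal fls_X * y)"
    using lim_map_eq_iff[OF assms(1) *] hlat_X[OF y] by simp
  ultimately show ?thesis
    by simp
qed



section \<open>The relations of the limit\<close>

lemma hlat_scal: "c \<in> PS \<Longrightarrow> p \<in> hlat \<Longrightarrow> scal c * p \<in> hlat"
  by (rule hlat_mult_left[OF _ lat_scal])

text \<open>
  The commutators with \<open>w\<close> and with \<open>W = w + w\<^sup>* = - ((1 + \<mu>) / 2) T\<close> before passing to the limit.
  Each is linear in the defining relations, and the factor \<open>1 / h\<close> in \<open>w\<close> combines with
  \<open>\<mu> - 1\<close> to \<open>\<delta>\<close>.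
\<close>

lemma commutators_w:
  fixes m :: free_alg
  defines "m \<equiv> scal (mu \<kappa>)"
  defines "W \<equiv> lift_w + lift_w'"
  shows "\<rho> * lift_w - lift_w * \<rho> - scal delta * (\<sigma>' * \<rho> + \<rho> * \<sigma>) \<in> su_kernel \<kappa>"
    and "\<sigma> * lift_w - lift_w * \<sigma> +
      scal delta * (\<rho> * \<rho>' + m * (\<rho> * \<rho>') + \<rho> * \<sigma> + m * (\<rho>' * \<sigma>)) \<in> su_kernel \<kappa>"
    and "\<rho> * W - W * \<rho> \<in> su_kernel \<kappa>"
    and "\<sigma> * W - m * (W * \<sigma>) \<in> su_kernel \<kappa>"
    and "lift_w * W - W * lift_w + scal delta * (W * \<sigma> + \<sigma>' * W) \<in> su_kernel \<kappa>"
proof -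
  define x where "x = - \<sigma> - \<rho> - m * \<rho>' + \<sigma>'"
  define r where "r = fls_X_inv * (1/2 :: complex fls)"
  define c where "c = - (r * (1 + mu \<kappa>))"
  define P where "P = \<rho> + \<rho>'"
  note K = relations_in_kernel[folded m_def]
  have w: "lift_w = scal r * x"
    by (simp only: lift_w_def r_def x_def m_def)
  have W: "W = scal c * P"
    by (intro poly_mapping_eqI) (simp add: P_def W_def lift_defs c_def r_def free_linear)
  have "scal delta = scal r * (m - 1)"
    by (simp only: delta_def r_def m_def scal_simps)
  then have delta: "scal delta * p = scal r * ((m - 1) * p)" for p
    by (simp add: mult.assoc)
  have scal_left: "p * (scal d * p') = scal d * (p * p')" for d p p'
    by (metis mult.assoc scal_commute)
  have gen_comm: "gen l * m = m * gen l" "gen l * (m * p) = m * (gen l * p)" for l p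
    by (simp_all only: m_def scal_left scal_commute[of _ "gen l"])
  have swap: "scal c * (scal r * p) = scal r * (scal c * p)" for p
    by (rule scal_left)
  note simps = mult.assoc distrib_left right_diff_distrib swap
    scal_left[of "gen _"] scal_left[of x] scal_left[of m] scal_left[of "m - 1"] scal_left[of P]
  have "\<rho> * lift_w - lift_w * \<rho> - scal delta * (\<sigma>' * \<rho> + \<rho> * \<sigma>) =
      scal r * (\<rho> * x - x * \<rho> - (m - 1) * (\<sigma>' * \<rho> + \<rho> * \<sigma>))"
    by (simp add: w delta simps)
  also have "\<rho> * x - x * \<rho> - (m - 1) * (\<sigma>' * \<rho> + \<rho> * \<sigma>) =
      (\<rho> * \<sigma>' - m * (\<sigma>' * \<rho>)) + (\<sigma> * \<rho> - m * (\<rho> * \<sigma>)) - m * (\<rho> * \<rho>' - \<rho>' * \<rho>)"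
    by (simp add: x_def algebra_simps gen_comm)
  finally show "\<rho> * lift_w - lift_w * \<rho> - scal delta * (\<sigma>' * \<rho> + \<rho> * \<sigma>) \<in> su_kernel \<kappa>"
    by (simp only:) (intro K kernel_mult_left kernel_diff kernel_add)
  have "\<sigma> * lift_w - lift_w * \<sigma> +
      scal delta * (\<rho> * \<rho>' + m * (\<rho> * \<rho>') + \<rho> * \<sigma> + m * (\<rho>' * \<sigma>)) =
      scal r * (\<sigma> * x - x * \<sigma> +
        (m - 1) * (\<rho> * \<rho>' + m * (\<rho> * \<rho>') + \<rho> * \<sigma> + m * (\<rho>' * \<sigma>)))"
    by (simp add: w delta simps)
  also have "\<sigma> * x - x * \<sigma> +
        (m - 1) * (\<rho> * \<rho>' + m * (\<rho> * \<rho>') + \<rho> * \<sigma> + m * (\<rho>' * \<sigma>)) =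
      (\<sigma> * \<sigma>' + m * m * (\<rho> * \<rho>') - 1) - (\<sigma>' * \<sigma> + \<rho> * \<rho>' - 1) -
      (\<sigma> * \<rho> - m * (\<rho> * \<sigma>)) - m * (\<sigma> * \<rho>' - m * (\<rho>' * \<sigma>))"
    by (simp add: x_def algebra_simps gen_comm)
  finally show "\<sigma> * lift_w - lift_w * \<sigma> +
      scal delta * (\<rho> * \<rho>' + m * (\<rho> * \<rho>') + \<rho> * \<sigma> + m * (\<rho>' * \<sigma>)) \<in> su_kernel \<kappa>"
    by (simp only:) (intro K kernel_mult_left kernel_diff kernel_add)
  have "\<rho> * W - W * \<rho> = scal c * (\<rho> * \<rho>' - \<rho>' * \<rho>)"
    unfolding W P_def by (simp add: simps distrib_right)
  then show "\<rho> * W - W * \<rho> \<in> su_kernel \<kappa>"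
    by (simp only:) (intro K kernel_mult_left kernel_diff kernel_add)
  have "\<sigma> * W - m * (W * \<sigma>) =
      scal c * ((\<sigma> * \<rho> - m * (\<rho> * \<sigma>)) + (\<sigma> * \<rho>' - m * (\<rho>' * \<sigma>)))"
    unfolding W P_def by (simp add: simps distrib_right)
  then show "\<sigma> * W - m * (W * \<sigma>) \<in> su_kernel \<kappa>"
    by (simp only:) (intro K kernel_mult_left kernel_diff kernel_add)
  have "lift_w * W - W * lift_w + scal delta * (W * \<sigma> + \<sigma>' * W) =
      scal r * (scal c * (x * P - P * x + (m - 1) * (P * \<sigma> + \<sigma>' * P)))"
    unfolding W w delta by (simp add: simps)
  also have "x * P - P * x + (m - 1) * (P * \<sigma> + \<sigma>' * P) =
      m * (\<rho> * \<rho>' - \<rho>' * \<rho>) - (\<rho> * \<rho>' - \<rho>' * \<rho>) -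
      (\<sigma> * \<rho> - m * (\<rho> * \<sigma>)) - (\<sigma> * \<rho>' - m * (\<rho>' * \<sigma>)) -
      (\<rho> * \<sigma>' - m * (\<sigma>' * \<rho>)) - (\<rho>' * \<sigma>' - m * (\<sigma>' * \<rho>'))"
    by (simp add: x_def P_def algebra_simps gen_comm)
  finally show "lift_w * W - W * lift_w + scal delta * (W * \<sigma> + \<sigma>' * W) \<in> su_kernel \<kappa>"
    by (simp only:) (intro K kernel_mult_left kernel_diff kernel_add)
qed

text \<open>The limit \<open>1 / (2 \<kappa>)\<close> of \<open>\<delta>\<close>.\<close>

definition tau :: "complex fls" where "tau = fls_const (complex_of_real (1 / (2 * \<kappa>)))"

text \<open>
  The relations of \<open>E\<close> in terms of \<open>\<sigma>, \<rho>, w, W\<close>: \<open>\<sigma>, \<rho>, W\<close> commute, \<open>\<sigma>\<^sup>2 - \<rho>\<^sup>2 = 1\<close>,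
  \<open>[\<rho>, w] = \<rho> \<sigma> / \<kappa>\<close>, \<open>[\<sigma>, w] = \<rho>\<^sup>2 / \<kappa>\<close> and \<open>[w, W] = - \<sigma> W / \<kappa>\<close>; commutation of \<open>\<rho>\<close>, \<open>\<sigma>\<close>
  with \<open>W\<close> gives the commutators with \<open>w\<^sup>* = W - w\<close>.  Finally \<open>a = \<sigma> + \<rho>\<close> and \<open>a\<^sup>* = \<sigma> - \<rho>\<close>.
\<close>

lemma limit_relations:
  defines "W \<equiv> lift_w + lift_w'"
  shows "\<sigma> * \<rho> - \<rho> * \<sigma> \<in> hlat"
    and "\<sigma> * \<sigma> - \<rho> * \<rho> - 1 \<in> hlat"
    and "\<rho> * lift_w - lift_w * \<rho> - scal tau * (\<rho> * \<sigma> + \<rho> * \<sigma>) \<in> hlat"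
    and "\<sigma> * lift_w - lift_w * \<sigma> - scal tau * (\<rho> * \<rho> + \<rho> * \<rho>) \<in> hlat"
    and "\<rho> * W - W * \<rho> \<in> hlat"
    and "\<sigma> * W - W * \<sigma> \<in> hlat"
    and "lift_w * W - W * lift_w + scal tau * (\<sigma> * W + \<sigma> * W) \<in> hlat"
    and "lift_a - (\<sigma> + \<rho>) \<in> hlat"
    and "lift_a' - (\<sigma> - \<rho>) \<in> hlat"
proof -
  define m where "m = scal (mu \<kappa>)"
  note K = relations_in_kernel[folded m_def, THEN hlat_kernel]
  note Kw = commutators_w[folded m_def W_def, THEN hlat_kernel]
  note h = hlat_add hlat_diff
  note lat = lat_gen lat_lifts lat_mult lat_add lat_diff
  have W: "W \<in> lat"
    unfolding W_def by (intro lat)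
  have m1: "(m - 1) * p \<in> hlat" if "p \<in> lat" for p
    using hlat_small_scal[of "mu \<kappa> - 1" p] that
    by (simp add: mu_PS PS_closed m_def scal_simps(2,4) del: single_one)
  have small: "scal (delta - tau) * p \<in> hlat" if "p \<in> lat" for p
    using that by (intro hlat_small_scal) (simp_all add: delta_PS PS_closed tau_def)
  have delta: "scal delta * p \<in> hlat" if "p \<in> hlat" for p
    using that by (simp add: hlat_scal delta_PS)
  note real = hlat_adjoints
    hlat_mult_left[OF hlat_adjoints(1) lat_gen] hlat_mult_left[OF hlat_adjoints(2) lat_gen]
    hlat_mult_right[OF hlat_adjoints(1) lat_gen] hlat_mult_right[OF hlat_adjoints(2) lat_gen]
    hlat_mult_right[OF hlat_adjoints(2) W]
  have "\<sigma> * \<rho> - \<rho> * \<sigma> = (\<sigma> * \<rho> - m * (\<rho> * \<sigma>)) + (m - 1) * (\<rho> * \<sigma>)"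
    by (simp add: algebra_simps)
  also have "\<dots> \<in> hlat"
    by (intro K m1 h lat)
  finally show 1: "\<sigma> * \<rho> - \<rho> * \<sigma> \<in> hlat" .
  have "\<sigma> * \<sigma> - \<rho> * \<rho> - 1 = (\<sigma> * \<sigma>' + m * m * (\<rho> * \<rho>') - 1) + \<sigma> * (\<sigma> - \<sigma>') -
      \<rho> * (\<rho> + \<rho>') - (m - 1) * (\<rho> * \<rho>') - m * ((m - 1) * (\<rho> * \<rho>'))"
    by (simp add: algebra_simps)
  also have "\<dots> \<in> hlat"
    by (intro K hlat_mult_left[OF m1] m1 real h lat) (simp add: m_def lat_scal mu_PS)
  finally show "\<sigma> * \<sigma> - \<rho> * \<rho> - 1 \<in> hlat" .
  have "\<rho> * lift_w - lift_w * \<rho> - scal tau * (\<rho> * \<sigma> + \<rho> * \<sigma>) =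
      (\<rho> * lift_w - lift_w * \<rho> - scal delta * (\<sigma>' * \<rho> + \<rho> * \<sigma>)) +
      scal delta * ((\<sigma> * \<rho> - \<rho> * \<sigma>) - (\<sigma> - \<sigma>') * \<rho>) + scal (delta - tau) * (\<rho> * \<sigma> + \<rho> * \<sigma>)"
    by (simp add: scal_simps(4) algebra_simps)
  also have "\<dots> \<in> hlat"
    by (intro Kw 1 delta small real h lat)
  finally show "\<rho> * lift_w - lift_w * \<rho> - scal tau * (\<rho> * \<sigma> + \<rho> * \<sigma>) \<in> hlat" .
  have "\<sigma> * lift_w - lift_w * \<sigma> - scal tau * (\<rho> * \<rho> + \<rho> * \<rho>) =
      (\<sigma> * lift_w - lift_w * \<sigma> +
        scal delta * (\<rho> * \<rho>' + m * (\<rho> * \<rho>') + \<rho> * \<sigma> + m * (\<rho>' * \<sigma>))) -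
      scal delta * ((m - 1) * (\<rho> * \<rho>') + \<rho> * (\<rho> + \<rho>') + \<rho> * (\<rho> + \<rho>') + (\<rho> + \<rho>') * \<sigma> +
        (m - 1) * (\<rho>' * \<sigma>)) + scal (delta - tau) * (\<rho> * \<rho> + \<rho> * \<rho>)"
    by (simp add: scal_simps(4) algebra_simps)
  also have "\<dots> \<in> hlat"
    by (intro Kw delta small m1 real h lat)
  finally show "\<sigma> * lift_w - lift_w * \<sigma> - scal tau * (\<rho> * \<rho> + \<rho> * \<rho>) \<in> hlat" .
  show "\<rho> * W - W * \<rho> \<in> hlat"
    by (rule Kw)
  have "\<sigma> * W - W * \<sigma> = (\<sigma> * W - m * (W * \<sigma>)) + (m - 1) * (W * \<sigma>)"
    by (simp add: algebra_simps)
  also have "\<dots> \<in> hlat"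
    by (intro Kw m1 h lat W)
  finally show 6: "\<sigma> * W - W * \<sigma> \<in> hlat" .
  have "lift_w * W - W * lift_w + scal tau * (\<sigma> * W + \<sigma> * W) =
      (lift_w * W - W * lift_w + scal delta * (W * \<sigma> + \<sigma>' * W)) +
      scal delta * ((\<sigma> - \<sigma>') * W + (\<sigma> * W - W * \<sigma>)) - scal (delta - tau) * (\<sigma> * W + \<sigma> * W)"
    by (simp add: scal_simps(4) algebra_simps)
  also have "\<dots> \<in> hlat"
    by (intro Kw 6 delta small real h lat W)
  finally show "lift_w * W - W * lift_w + scal tau * (\<sigma> * W + \<sigma> * W) \<in> hlat" .
  have half: "scal (1/2) * p \<in> hlat" if "p \<in> hlat" for p
    using that by (simp add: hlat_scal PS_half)
  have half_m1: "scal (1/2 * (1 - mu \<kappa>)) * p \<in> hlat" if "p \<in> lat" for p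
    using that by (intro hlat_small_scal) (simp_all only: PS_closed PS_half PS_nth_mult mu_PS, simp add: mu_PS)
  have "lift_a - (\<sigma> + \<rho>) =
      scal (1/2 * (1 - mu \<kappa>)) * \<rho>' - scal (1/2) * (\<sigma> - \<sigma>') - scal (1/2) * (\<rho> + \<rho>')"
    by (intro poly_mapping_eqI) (simp add: lift_defs free_linear)
  also have "\<dots> \<in> hlat"
    by (intro half half_m1 real h lat)
  finally show "lift_a - (\<sigma> + \<rho>) \<in> hlat" .
  have "lift_a' - (\<sigma> - \<rho>) =
      scal (1/2 * (1 - mu \<kappa>)) * \<rho> - scal (1/2) * (\<sigma> - \<sigma>') + scal (1/2) * (\<rho> + \<rho>')"
    by (intro poly_mapping_eqI) (simp add: lift_defs free_linear)
  also have "\<dots> \<in> hlat"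
    by (intro half half_m1 real h lat)
  finally show "lift_a' - (\<sigma> - \<rho>) \<in> hlat" .
qed



section \<open>The right ideal generated by the limit elements\<close>

text \<open>Representatives of the eight generators; \<open>three\<close> is kept in the form of a complex scalar.\<close>

definition limit_generators :: "free_alg set" where
  "limit_generators =
    (let q = scal tau; q4 = scal (fls_const (complex_of_real (1 / (4 * \<kappa>\<^sup>2))));
         three = scal (fls_const (complex_of_real 3)); a = lift_a; a' = lift_a'; w = lift_w; w' = lift_w'
     in
     {(a - 1) * (a' - 1),
      (a - 1) * w' + q * (a - a'),
      (a - 1) * w - q * (a - a'),
      (a' - 1) * w' - q * (a - a'),
      (a' - 1) * w + q * (a - a'),
      w' * w + q * (w - three * w') - q4 * (a - a'),
      w * w + q * (w' - three * w) + q4 * (a - a'),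
      w' * w' - q * (w - three * w') + q4 * (a - a')})"

lemma limit_generators_lat: "limit_generators \<subseteq> lat"
  unfolding limit_generators_def Let_def tau_def
  by (intro insert_subsetI empty_subsetI lat_add lat_diff lat_mult lat_scal lat_lifts lat_one PS_closed)

lemma limit_generators_ct:
  assumes "p \<in> limit_generators"
  shows "ct (character 1) p = 0 \<and> ct coord_rho p = 0 \<and> ct coord_T p = 0 \<and> ct coord_U p = 0"
proof -
  define t where "t = complex_of_real (1 / (2 * \<kappa>))"
  \<comment> \<open>Naming the number keeps its scalar from being rewritten into a numeral of the free algebra.\<close>
  define three where "three = complex_of_real 3"
  have t2: "complex_of_real (1 / (4 * \<kappa>\<^sup>2)) = t * t"
    by (simp add: t_def power2_eq_square)
  note lat = lat_mult lat_add lat_diff lat_scal lat_lifts lat_one PS_closed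
  show ?thesis
    using assms unfolding limit_generators_def Let_def tau_def t2 t_def[symmetric] three_def[symmetric]
    by (elim insertE emptyE; hypsubst; simp add: ct_mult lat ct_lifts[folded t_def];
        simp add: three_def algebra_simps)
qed

text \<open>The representatives of the elements of the right ideal \<open>J\<close> of \<open>E\<close> generated by the eight elements.\<close>

definition limit_ideal :: "free_alg set" where
  "limit_ideal = {p \<in> lat. lim_map p \<in> right_genideal (E_tilde \<kappa>) (lim_map ` limit_generators)}"

lemma limit_ideal_closed:
  shows limit_ideal_lat: "p \<in> limit_ideal \<Longrightarrow> p \<in> lat"
    and limit_ideal_hlat: "p \<in> hlat \<Longrightarrow> p \<in> limit_ideal"
    and limit_ideal_add: "p \<in> limit_ideal \<Longrightarrow> q \<in> limit_ideal \<Longrightarrow> p + q \<in> limit_ideal"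
    and limit_ideal_diff: "p \<in> limit_ideal \<Longrightarrow> q \<in> limit_ideal \<Longrightarrow> p - q \<in> limit_ideal"
    and limit_ideal_mult: "p \<in> limit_ideal \<Longrightarrow> q \<in> lat \<Longrightarrow> p * q \<in> limit_ideal"
    and limit_ideal_scal: "p \<in> limit_ideal \<Longrightarrow> c \<in> PS \<Longrightarrow> scal c * p \<in> limit_ideal"
    and limit_ideal_generators: "limit_generators \<subseteq> limit_ideal"
proof -
  have "lim_map ` limit_generators \<subseteq> carrier (E_tilde \<kappa>)"
    using limit_generators_lat E.hom_carrier by blast
  note I = right_ideal_right_genideal[OF ring_E_tilde this]
  show "p \<in> limit_ideal \<Longrightarrow> p \<in> lat"
    by (simp add: limit_ideal_def)
  show "p \<in> limit_ideal" if "p \<in> hlat"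
  proof -
    have "lim_map p = lim_map 0"
      using that lim_map_eq_iff[OF hlat_lat[OF that] E.zero_S] by simp
    then show ?thesis
      using E.right_ideal_zero[OF I(1)] hlat_lat[OF that] by (simp add: limit_ideal_def)
  qed
  show "p \<in> limit_ideal \<Longrightarrow> q \<in> limit_ideal \<Longrightarrow> p + q \<in> limit_ideal" "p \<in> limit_ideal \<Longrightarrow> q \<in> limit_ideal \<Longrightarrow> p - q \<in> limit_ideal"
    using E.right_ideal_add[OF I(1)] E.right_ideal_diff[OF I(1)]
    by (simp_all add: limit_ideal_def lat_add lat_diff)
  show mult: "p \<in> limit_ideal \<Longrightarrow> q \<in> lat \<Longrightarrow> p * q \<in> limit_ideal" for p q
    using E.right_ideal_mult[OF I(1)] by (simp add: limit_ideal_def lat_mult)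
  show "p \<in> limit_ideal \<Longrightarrow> c \<in> PS \<Longrightarrow> scal c * p \<in> limit_ideal"
    using mult[of p "scal c"] by (simp add: scal_commute lat_scal)
  show "limit_generators \<subseteq> limit_ideal"
    using I(2) limit_generators_lat by (auto simp: limit_ideal_def)
qed

lemma limit_genideal_ct_zero:
  "right_genideal (E_tilde \<kappa>) (lim_map ` limit_generators) \<subseteq>
    lim_map ` {p \<in> lat. ct (character 1) p = 0 \<and> ct coord_rho p = 0 \<and> ct coord_T p = 0 \<and> ct coord_U p = 0}"
  using limit_generators_lat limit_generators_ct
  by (intro E.right_genideal_subset_image image_mono) (auto simp: lat_closed E.zero_S ct_mult)

lemma limit_ideal_ct_zero:
  assumes "p \<in> limit_ideal"
  shows "ct (character 1) p = 0 \<and> ct coord_rho p = 0 \<and> ct coord_T p = 0 \<and> ct coord_U p = 0"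
proof -
  obtain z where z: "z \<in> lat" "lim_map p = lim_map z"
      "ct (character 1) z = 0" "ct coord_rho z = 0" "ct coord_T z = 0" "ct coord_U z = 0"
    using assms limit_genideal_ct_zero by (auto simp: limit_ideal_def)
  then have "p - z \<in> hlat"
    using assms by (simp add: lim_map_eq_iff limit_ideal_lat)
  then show ?thesis
    using hlat_ct_zero[of "p - z"] z by simp
qed

interpretation JS: coset_span "range fls_const" limit_ideal \<rho> lift_w lift_w'
proof
  show "(0 :: complex fls) \<in> range fls_const" "(1 :: complex fls) \<in> range fls_const"
    by (metis fls_const_0 rangeI) (metis fls_const_1 rangeI)
  show "c + d \<in> range fls_const" "c * d \<in> range fls_const"
    if "c \<in> range fls_const" "d \<in> range fls_const" for c d :: "complex fls"
    using that fls_plus_const[of _ "_ :: complex"] by auto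
  show "0 \<in> limit_ideal"
    using kernel_zero hlat_kernel limit_ideal_hlat by blast
  show "scal c * p \<in> limit_ideal" if "c \<in> range fls_const" "p \<in> limit_ideal" for c p
    using that by (auto intro!: limit_ideal_scal PS_closed)
qed (rule limit_ideal_add)

text \<open>
  \<open>E = J + span\<^sub>\<complex>(1, \<rho>, w, w\<^sup>*)\<close>.  Modulo \<open>J\<close> one has \<open>\<sigma> = 1\<close>, and right multiplication by
  \<open>\<sigma>\<close> is the identity; \<open>\<rho> \<rho>\<close>, \<open>w \<rho>\<close>, \<open>w\<^sup>* \<rho>\<close> vanish; \<open>\<rho> w = \<rho> / \<kappa>\<close> and \<open>\<rho> w\<^sup>* = - \<rho> / \<kappa>\<close>;
  the products of \<open>w\<close> and \<open>w\<^sup>*\<close> are given by the three quadratic generators and \<open>[w, w\<^sup>*]\<close>.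
\<close>

lemma limit_ideal_span:
  assumes "p \<in> lat" shows "p \<in> JS.span"
proof -
  define q where "q = scal tau"
  define q4 where "q4 = scal (fls_const (complex_of_real (1 / (4 * \<kappa>\<^sup>2))))"
  define three where "three = scal (fls_const (complex_of_real 3))"
  define W where "W = lift_w + lift_w'"
  define e where "e = lift_a - (\<sigma> + \<rho>)"
  define e' where "e' = lift_a' - (\<sigma> - \<rho>)"
  have a: "lift_a = \<sigma> + \<rho> + e" "lift_a' = \<sigma> - \<rho> + e'"
    by (simp_all add: e_def e'_def)
  note R = limit_relations[folded q_def W_def e_def e'_def]
  note lat = lat_gen lat_one lat_lifts lat_mult lat_add lat_diff
  have W: "W \<in> lat"
    unfolding W_def by (intro lat)
  note J = limit_ideal_add limit_ideal_diff
  have q: "q * p \<in> limit_ideal" if "p \<in> limit_ideal" for p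
    using that by (simp add: q_def limit_ideal_scal tau_def PS_closed)
  have const: "fls_const c \<in> range fls_const" for c :: complex
    by simp
  have gens: "(lift_a - 1) * (lift_a' - 1) \<in> limit_ideal"
    "(lift_a - 1) * lift_w' + q * (lift_a - lift_a') \<in> limit_ideal"
    "(lift_a - 1) * lift_w - q * (lift_a - lift_a') \<in> limit_ideal"
    "lift_w' * lift_w + q * (lift_w - three * lift_w') - q4 * (lift_a - lift_a') \<in> limit_ideal"
    "lift_w * lift_w + q * (lift_w' - three * lift_w) + q4 * (lift_a - lift_a') \<in> limit_ideal"
    "lift_w' * lift_w' - q * (lift_w - three * lift_w') + q4 * (lift_a - lift_a') \<in> limit_ideal"
    using limit_ideal_generators by (simp_all add: limit_generators_def Let_def q_def q4_def three_def)
  have he: "e \<in> limit_ideal" "e' \<in> limit_ideal"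
    using R(8,9) by (simp_all add: limit_ideal_hlat)

  \<comment> \<open>In the limit \<open>a = \<sigma> + \<rho>\<close>, \<open>a' = \<sigma> - \<rho>\<close>, \<open>\<sigma>\<close> and \<open>\<rho>\<close> commute and \<open>\<sigma>\<^sup>2 - \<rho>\<^sup>2 = 1\<close>, so
    that the first generator is \<open>2 - 2 \<sigma>\<close>.\<close>
  have "(\<sigma> - 1) + (\<sigma> - 1) = (\<sigma> * \<sigma> - \<rho> * \<rho> - 1) - (\<sigma> * \<rho> - \<rho> * \<sigma>) + (lift_a - 1) * e' +
      e * (\<sigma> - \<rho> - 1) - (lift_a - 1) * (lift_a' - 1)"
    by (simp add: a algebra_simps)
  also have "\<dots> \<in> limit_ideal"
    by (intro gens limit_ideal_hlat[OF R(1)] limit_ideal_hlat[OF R(2)] limit_ideal_mult[OF he(1)]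
        limit_ideal_hlat[OF hlat_mult_left[OF R(9)]] J lat)
  finally have "scal (1/2) * ((\<sigma> - 1) + (\<sigma> - 1)) \<in> limit_ideal"
    by (rule limit_ideal_scal) (rule PS_half)
  then have s: "(\<sigma> - 1) * r \<in> limit_ideal" if "r \<in> lat" for r
    using limit_ideal_mult that by (simp only: scal_half_double)
  have rw: "\<rho> * lift_w - q * (\<rho> + \<rho>) \<in> limit_ideal"
  proof -
    have "\<rho> * lift_w - q * (\<rho> + \<rho>) = ((lift_a - 1) * lift_w - q * (lift_a - lift_a')) -
        (\<sigma> - 1) * lift_w - e * lift_w + q * (e - e')"
      by (simp add: a algebra_simps)
    also have "\<dots> \<in> limit_ideal"
      by (intro gens s limit_ideal_mult[OF he(1)] q J he lat)
    finally show ?thesis .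
  qed
  have rw': "\<rho> * lift_w' + q * (\<rho> + \<rho>) \<in> limit_ideal"
  proof -
    have "\<rho> * lift_w' + q * (\<rho> + \<rho>) = ((lift_a - 1) * lift_w' + q * (lift_a - lift_a')) -
        (\<sigma> - 1) * lift_w' - e * lift_w' - q * (e - e')"
      by (simp add: a algebra_simps)
    also have "\<dots> \<in> limit_ideal"
      by (intro gens s limit_ideal_mult[OF he(1)] q J he lat)
    finally show ?thesis .
  qed
  have rr: "\<rho> * \<rho> \<in> limit_ideal"
  proof -
    have "\<rho> * \<rho> = (\<sigma> - 1) * (\<sigma> + 1) - (\<sigma> * \<sigma> - \<rho> * \<rho> - 1)"
      by (simp add: algebra_simps)
    also have "\<dots> \<in> limit_ideal"
      by (intro J s limit_ideal_hlat[OF R(2)] lat)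
    finally show ?thesis .
  qed
  have rs: "\<rho> * \<sigma> - \<rho> \<in> limit_ideal"
  proof -
    have "\<rho> * \<sigma> - \<rho> = (\<sigma> - 1) * \<rho> - (\<sigma> * \<rho> - \<rho> * \<sigma>)"
      by (simp add: algebra_simps)
    also have "\<dots> \<in> limit_ideal"
      by (intro J s limit_ideal_hlat[OF R(1)] lat)
    finally show ?thesis .
  qed
  have ws: "lift_w * \<sigma> - lift_w \<in> limit_ideal"
  proof -
    have "lift_w * \<sigma> - lift_w = (\<sigma> - 1) * lift_w -
        (\<sigma> * lift_w - lift_w * \<sigma> - q * (\<rho> * \<rho> + \<rho> * \<rho>)) - q * (\<rho> * \<rho> + \<rho> * \<rho>)"
      by (simp add: algebra_simps)
    also have "\<dots> \<in> limit_ideal"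
      by (intro limit_ideal_hlat[OF R(4)] s rr q J lat)
    finally show ?thesis .
  qed
  have w's: "lift_w' * \<sigma> - lift_w' \<in> limit_ideal"
  proof -
    have "lift_w' * \<sigma> - lift_w' = (\<sigma> - 1) * W - (\<sigma> * W - W * \<sigma>) - (lift_w * \<sigma> - lift_w)"
      by (simp add: W_def algebra_simps)
    also have "\<dots> \<in> limit_ideal"
      by (intro limit_ideal_hlat[OF R(6)] s ws W J)
    finally show ?thesis .
  qed
  have wr: "lift_w * \<rho> \<in> limit_ideal"
  proof -
    have "lift_w * \<rho> = (\<rho> * lift_w - q * (\<rho> + \<rho>)) -
        (\<rho> * lift_w - lift_w * \<rho> - q * (\<rho> * \<sigma> + \<rho> * \<sigma>)) - q * ((\<rho> * \<sigma> - \<rho>) + (\<rho> * \<sigma> - \<rho>))"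
      by (simp add: algebra_simps)
    also have "\<dots> \<in> limit_ideal"
      by (intro limit_ideal_hlat[OF R(3)] rw rs q J)
    finally show ?thesis .
  qed
  have w'r: "lift_w' * \<rho> \<in> limit_ideal"
  proof -
    have "lift_w' * \<rho> = (\<rho> * lift_w - q * (\<rho> + \<rho>)) + (\<rho> * lift_w' + q * (\<rho> + \<rho>)) -
        (\<rho> * W - W * \<rho>) - lift_w * \<rho>"
      by (simp add: W_def algebra_simps)
    also have "\<dots> \<in> limit_ideal"
      by (intro limit_ideal_hlat[OF R(5)] rw rw' wr J)
    finally show ?thesis .
  qed

  have neg: "(- 1 :: complex fls) \<in> range fls_const"
    by (metis fls_const_1 fls_const_uminus rangeI)
  note S = JS.span_add JS.span_diff[OF neg]
  have S_scal: "q * p \<in> JS.span" "q4 * p \<in> JS.span" "three * p \<in> JS.span" if "p \<in> JS.span" for p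
    using that unfolding q_def q4_def three_def tau_def by (intro JS.span_scal const; assumption)+
  note P = JS.span_P
  have transfer: "p \<in> JS.span" if "p - r \<in> JS.span" "r \<in> JS.span" for p r
    using JS.span_add[OF that] by simp
  note basis = JS.span_basis
  have Sa: "lift_a - lift_a' \<in> JS.span"
  proof -
    have "lift_a - lift_a' = \<rho> + \<rho> + (e - e')"
      by (simp add: a)
    also have "\<dots> \<in> JS.span"
      by (intro P he basis S)
    finally show ?thesis .
  qed
  have Ss: "\<sigma> \<in> JS.span" "\<rho> * \<sigma> \<in> JS.span" "lift_w * \<sigma> \<in> JS.span" "lift_w' * \<sigma> \<in> JS.span"
    using transfer[OF P[OF rs] basis(2)] transfer[OF P[OF ws] basis(3)] transfer[OF P[OF w's] basis(4)]
      transfer[OF P[OF s[OF lat_one], simplified] basis(1)] by simp_all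
  have Sr: "\<rho> \<in> JS.span" "\<rho> * \<rho> \<in> JS.span" "lift_w * \<rho> \<in> JS.span" "lift_w' * \<rho> \<in> JS.span"
    by (intro basis P rr wr w'r)+
  have SW: "W \<in> JS.span" "\<sigma> * W \<in> JS.span"
  proof -
    show *: "W \<in> JS.span"
      unfolding W_def by (intro S basis)
    show "\<sigma> * W \<in> JS.span"
      using transfer[of "\<sigma> * W" W] P[OF s[OF W]] * by (simp add: left_diff_distrib)
  qed
  have Sww: "lift_w * lift_w \<in> JS.span"
  proof -
    have "lift_w * lift_w =
        (lift_w * lift_w + q * (lift_w' - three * lift_w) + q4 * (lift_a - lift_a')) -
        q * (lift_w' - three * lift_w) - q4 * (lift_a - lift_a')"
      by simp
    also have "\<dots> \<in> JS.span"
      by (intro P[OF gens(5)] S_scal Sa basis S)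
    finally show ?thesis .
  qed
  have Sw'w': "lift_w' * lift_w' \<in> JS.span"
  proof -
    have "lift_w' * lift_w' =
        (lift_w' * lift_w' - q * (lift_w - three * lift_w') + q4 * (lift_a - lift_a')) +
        q * (lift_w - three * lift_w') - q4 * (lift_a - lift_a')"
      by simp
    also have "\<dots> \<in> JS.span"
      by (intro P[OF gens(6)] S_scal Sa basis S)
    finally show ?thesis .
  qed
  have Sw'w: "lift_w' * lift_w \<in> JS.span"
  proof -
    have "lift_w' * lift_w =
        (lift_w' * lift_w + q * (lift_w - three * lift_w') - q4 * (lift_a - lift_a')) -
        q * (lift_w - three * lift_w') + q4 * (lift_a - lift_a')"
      by simp
    also have "\<dots> \<in> JS.span"
      by (intro P[OF gens(4)] S_scal Sa basis S)
    finally show ?thesis .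
  qed
  have Sww': "lift_w * lift_w' \<in> JS.span"
  proof -
    have "lift_w * lift_w' = (lift_w * W - W * lift_w + q * (\<sigma> * W + \<sigma> * W)) -
        q * (\<sigma> * W + \<sigma> * W) + lift_w' * lift_w"
      by (simp add: W_def algebra_simps)
    also have "\<dots> \<in> JS.span"
      by (intro P[OF limit_ideal_hlat[OF R(7)]] S_scal SW Sw'w S)
    finally show ?thesis .
  qed
  have Srw: "\<rho> * lift_w \<in> JS.span" "\<rho> * lift_w' \<in> JS.span"
  proof -
    have *: "q * (\<rho> + \<rho>) \<in> JS.span"
      by (intro S_scal S basis)
    show "\<rho> * lift_w \<in> JS.span"
      by (rule transfer[OF P[OF rw] *])
    show "\<rho> * lift_w' \<in> JS.span"
      using JS.span_diff[OF neg P[OF rw'] *] by simp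
  qed

  have hl: "b * k \<in> JS.span" if "k \<in> hlat" "b \<in> lat" for b k
    by (intro P limit_ideal_hlat hlat_mult_left that)
  have ba: "b * lift_a \<in> JS.span \<and> b * lift_a' \<in> JS.span"
    if "b \<in> lat" "b * \<sigma> \<in> JS.span" "b * \<rho> \<in> JS.span" for b
    unfolding a distrib_left right_diff_distrib
    using that hl[OF R(8) that(1)] hl[OF R(9) that(1)] by (intro conjI S)
  note ba = ba[OF lat_one] ba[OF lat_gen] ba[OF lat_lifts(3)] ba[OF lat_lifts(4)]
  have "p \<in> JS.span \<and> \<rho> * p \<in> JS.span \<and> lift_w * p \<in> JS.span \<and> lift_w' * p \<in> JS.span"
    using assms
  proof (induction rule: lat_induct)
    case (kernel k)
    then show ?case
      using hl[OF hlat_kernel[OF kernel]] lat_one lat_gen lat_lifts by (metis mult_1_left)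
  next
    case (scal c)
    \<comment> \<open>A power series is congruent to its constant term modulo \<open>h\<close>.\<close>
    define d where "d = fls_const (fls_nth c 0)"
    have "c - d \<in> PS" "fls_nth (c - d) 0 = 0"
      using scal by (simp_all add: d_def PS_closed)
    then have *: "scal (c - d) * b \<in> JS.span" if "b \<in> lat" for b
      by (intro P limit_ideal_hlat hlat_small_scal that)
    have **: "b * scal c \<in> JS.span" if "b \<in> lat" "b \<in> JS.span" for b
    proof -
      have "b * scal c = scal (c - d) * b + scal d * b"
        by (simp add: scal_commute[symmetric] scal_simps(4) left_diff_distrib)
      then show ?thesis
        using *[OF that(1)] JS.span_scal[OF that(2), of d] by (simp add: d_def JS.span_add)
    qed
    show ?case
      using **[OF lat_one basis(1)] **[OF lat_gen basis(2)] **[OF lat_lifts(3) basis(3)]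
        **[OF lat_lifts(4) basis(4)] by simp
  next
    case (uminus r)
    then show ?case
      using JS.span_scal[OF _ neg] by (simp add: scal_simps)
  next
    case (add r r')
    then show ?case
      by (simp add: distrib_left JS.span_add)
  next
    case (mult r r')
    then have "x * r' \<in> JS.span" if "x \<in> JS.span" for x
      using JS.span_mult_right[OF that limit_ideal_mult] by blast
    with mult show ?case
      by (simp add: mult.assoc[symmetric])
  next
    case a
    show ?case using ba Ss Sr by simp
  next
    case a'
    show ?case using ba Ss Sr by simp
  next
    case w
    show ?case using basis Srw Sww Sw'w by simp
  next
    case w'
    show ?case using basis Srw Sww' Sw'w' by simp
  qed
  then show ?thesis
    by blast
qed

lemma worono_lat_limit_ideal:
  assumes "p \<in> lat" "p \<in> worono"
  shows "p \<in> limit_ideal"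
proof -
  obtain d0 d1 d2 d3 where p: "p - (scal (fls_const d0) + scal (fls_const d1) * \<rho> +
      scal (fls_const d2) * lift_w + scal (fls_const d3) * lift_w') \<in> limit_ideal"
    using limit_ideal_span[OF assms(1)] by (auto elim!: JS.spanE)
  have gens: "ct (character 1) \<rho> = 0" "ct coord_rho \<rho> = 1" "ct coord_T \<rho> = 0" "ct coord_U \<rho> = 0"
    by (simp_all add: ct_def coord_defs)
  have p0: "ct (character 1) p = 0" "ct coord_rho p = 0" "ct coord_T p = 0" "ct coord_U p = 0"
    using worono_coords_zero[OF assms(2)] by (simp_all add: ct_def)
  note z = limit_ideal_ct_zero[OF p, simplified ct_linear ct_mult lat_closed PS_closed lat_gen p0 ct_lifts gens ct_scal]
  \<comment> \<open>The equations for the coordinates at \<open>1\<close>, \<open>U\<close> and \<open>T\<close>; \<open>d1\<close> then follows from the one at \<open>\<rho>\<close>.\<close>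
  have "d0 = 0" "d2 = d3" "d2 + d3 = 0"
    using z by (auto simp: algebra_simps)
  moreover from this have "d2 = 0" "d3 = 0"
    by auto
  moreover from this have "d1 = 0"
    using z by auto
  ultimately show ?thesis
    using p by simp
qed

lemma contraction_eq:
  "contraction \<kappa> (woronowicz_ideal \<kappa>) = right_genideal (E_tilde \<kappa>) (lim_map ` limit_generators)"
proof
  show "contraction \<kappa> (woronowicz_ideal \<kappa>) \<subseteq> right_genideal (E_tilde \<kappa>) (lim_map ` limit_generators)"
  proof
    fix x assume "x \<in> contraction \<kappa> (woronowicz_ideal \<kappa>)"
    then obtain y where y: "y \<in> woronowicz_ideal \<kappa>" "y \<in> lattice_alg \<kappa>" "x = limit_class \<kappa> y"
      by (auto simp: contraction_def)
    then obtain p where p: "y = su_class \<kappa> p"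
      using lattice_alg_carrier[of \<kappa>] by (auto simp: carrier_SU)
    then have "p \<in> limit_ideal"
      using y by (intro worono_lat_limit_ideal) (simp_all add: lat_def worono_def)
    then show "x \<in> right_genideal (E_tilde \<kappa>) (lim_map ` limit_generators)"
      using y p by (simp add: limit_ideal_def lim_map_def)
  qed
  show "right_genideal (E_tilde \<kappa>) (lim_map ` limit_generators) \<subseteq> contraction \<kappa> (woronowicz_ideal \<kappa>)"
    using limit_genideal_ct_zero contractionI by blast
qed

lemma lim_map_generators:
  fixes E :: "free_alg set set ring" (structure)
  assumes "E = E_tilde \<kappa>"
    and "sc = (\<lambda>c. limit_scal \<kappa> (complex_of_real c))"
    and "a = limit_class \<kappa> (su_a \<kappa>)"
    and "a' = limit_class \<kappa> (su_star (su_a \<kappa>))"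
    and "w = limit_class \<kappa> (su_w \<kappa>)"
    and "w' = limit_class \<kappa> (su_star (su_w \<kappa>))"
  shows "lim_map ` limit_generators =
    {(a \<ominus> \<one>) \<otimes> (a' \<ominus> \<one>),
     (a \<ominus> \<one>) \<otimes> w' \<oplus> sc (1/(2*\<kappa>)) \<otimes> (a \<ominus> a'),
     (a \<ominus> \<one>) \<otimes> w \<ominus> sc (1/(2*\<kappa>)) \<otimes> (a \<ominus> a'),
     (a' \<ominus> \<one>) \<otimes> w' \<ominus> sc (1/(2*\<kappa>)) \<otimes> (a \<ominus> a'),
     (a' \<ominus> \<one>) \<otimes> w \<oplus> sc (1/(2*\<kappa>)) \<otimes> (a \<ominus> a'),
     w' \<otimes> w \<oplus> sc (1/(2*\<kappa>)) \<otimes> (w \<ominus> sc 3 \<otimes> w') \<ominus> sc (1/(4*\<kappa>^2)) \<otimes> (a \<ominus> a'),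
     w \<otimes> w \<oplus> sc (1/(2*\<kappa>)) \<otimes> (w' \<ominus> sc 3 \<otimes> w) \<oplus> sc (1/(4*\<kappa>^2)) \<otimes> (a \<ominus> a'),
     w' \<otimes> w' \<ominus> sc (1/(2*\<kappa>)) \<otimes> (w \<ominus> sc 3 \<otimes> w') \<oplus> sc (1/(4*\<kappa>^2)) \<otimes> (a \<ominus> a')}"
proof -
  have sc: "sc c = lim_map (scal (fls_const (complex_of_real c)))" for c
    by (simp add: assms(2) limit_scal_def lim_map_def)
  have lifts: "a = lim_map lift_a" "a' = lim_map lift_a'" "w = lim_map lift_w" "w' = lim_map lift_w'"
    by (simp_all add: assms lim_map_def class_lifts)
  have scal: "scal (fls_const z) \<in> lat" for z
    by (intro lat_scal PS_closed)
  show ?thesis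
    unfolding limit_generators_def Let_def tau_def sc lifts assms(1)
    by (simp only: image_insert image_empty E.hom_add E.hom_diff E.hom_mult E.hom_one
        lat_add lat_diff lat_mult lat_one lat_lifts scal)
qed

end

theorem theorem2:
  fixes \<kappa> :: real
    and E :: "free_alg set set ring" (structure)
    and sc :: "real \<Rightarrow> free_alg set set"
    and a a' w w' :: "free_alg set set"
  assumes "\<kappa> \<noteq> 0"
    and "E = E_tilde \<kappa>"
    and "sc = (\<lambda>c. limit_scal \<kappa> (complex_of_real c))"
    and "a = limit_class \<kappa> (su_a \<kappa>)"
    and "a' = limit_class \<kappa> (su_star (su_a \<kappa>))"
    and "w = limit_class \<kappa> (su_w \<kappa>)"
    and "w' = limit_class \<kappa> (su_star (su_w \<kappa>))"
  shows "contraction \<kappa> (woronowicz_ideal \<kappa>) = right_genideal E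
    {(a \<ominus> \<one>) \<otimes> (a' \<ominus> \<one>),
     (a \<ominus> \<one>) \<otimes> w' \<oplus> sc (1/(2*\<kappa>)) \<otimes> (a \<ominus> a'),
     (a \<ominus> \<one>) \<otimes> w \<ominus> sc (1/(2*\<kappa>)) \<otimes> (a \<ominus> a'),
     (a' \<ominus> \<one>) \<otimes> w' \<ominus> sc (1/(2*\<kappa>)) \<otimes> (a \<ominus> a'),
     (a' \<ominus> \<one>) \<otimes> w \<oplus> sc (1/(2*\<kappa>)) \<otimes> (a \<ominus> a'),
     w' \<otimes> w \<oplus> sc (1/(2*\<kappa>)) \<otimes> (w \<ominus> sc 3 \<otimes> w') \<ominus> sc (1/(4*\<kappa>^2)) \<otimes> (a \<ominus> a'),
     w \<otimes> w \<oplus> sc (1/(2*\<kappa>)) \<otimes> (w' \<ominus> sc 3 \<otimes> w) \<oplus> sc (1/(4*\<kappa>^2)) \<otimes> (a \<ominus> a'),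
     w' \<otimes> w' \<ominus> sc (1/(2*\<kappa>)) \<otimes> (w \<ominus> sc 3 \<otimes> w') \<oplus> sc (1/(4*\<kappa>^2)) \<otimes> (a \<ominus> a')}"
  unfolding contraction_eq lim_map_generators[OF assms(2-7)] assms(2)[symmetric] ..

end
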